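(* Let $E$ be a Borel space and $Q$ a semi-Markov kernel on $\mathbb{R}_+\times E$ given $E$ satisfying: there exist $\delta>0$, $\epsilon>0$ with $Q(\delta,E\mid x)\le1-\epsilon$ for all $x\in E$. Let $c,g:E\to[0,\infty)$ be measurable and $T\in\mathbb{R}_+$. For each stopping time $\tau$, let $\pi_\tau=\{d^\tau_n,n\ge0\}$ be the policy induced by $\tau$. Then $$V^\tau(s,x)=U^{\pi_\tau}(s,x)=V^{\tau^s_{\pi_\tau}}(s,x)\qquad\text{for all }(s,x)\in[0,T]\times E,$$ where $\tau^s_{\pi_\tau}$ is the stopping time induced by $\pi_\tau$ and $s$.
   Context: SMP: Semi-Markov kernel means: for each $B\in\mathcal{B}(E)$, $x$, $t\mapsto Q(t,B\mid x)$ nondecreasing, right-continuous, $Q(0,B\mid x)=0$; $Q(t,\cdot\mid\cdot)$ substochastic; $\lim_{t\to\infty}Q(t,\cdot\mid\cdot)$ stochastic. $\Omega=\{(x_0,t_1,x_1,\dots): x_0\in E,(t_n,x_n)\in\mathbb{R}_+\times E\}$; $X_n(\omega)=x_n$, $T_0=0$, $T_{n+1}(\omega)=t_{n+1}$, $S_n=\sum_{k=0}^nT_k$, $Y_n=(X_0,T_1,X_1,\dots,T_n,X_n)$, $\mathcal{F}_n=\sigma(T_0,X_0,\dots,T_n,X_n)$; $\mathbb{P}_x$ is the unique probability with $\mathbb{P}_x(T_0=0,X_0=x)=1$ and $\mathbb{P}_x(T_{n+1}\le t,X_{n+1}\in B\mid Y_n)=Q(t,B\mid X_n)$, $\mathbb{E}_x$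 its expectation; $X(t)=X_n$ for $S_n\le t<S_{n+1}$. A stopping time is $\tau:\Omega\to\mathbb{N}\cup\{\infty\}$ ($\mathbb{N}=\{0,1,\dots\}$) with $\{\tau=n\}\in\mathcal{F}_n$. $R^s_\tau=\int_0^{S_\tau}c(X(t))\,dt+g(X(S_\tau))$ if $S_\tau<s$, and $\int_0^sc(X(t))\,dt$ if $S_\tau\ge s$ ($S_\tau=\lim_nS_n$ on $\{\tau=\infty\}$); $V^\tau(s,x)=\mathbb{E}_x[R^s_\tau]$. Constructed SMDP: $\hat E=E\cup\{\Delta\}$, $A=\{0,1\}$, $A(x)=\{0,1\}$ for $x\in E$, $A(\Delta)=\{1\}$; $\hat Q_T(t,B\mid x,0)=Q(t,B\setminus\{\Delta\}\mid x)$ for $x\in E$, $\hat Q_T(t,B\mid x,1)=\mathbf{1}_{[T+1,\infty)}(t)\delta_\Delta(B)$ for $x\in\hat E$; $\hat c(x,a)=c(x)$ if $x\in E,a=0$, else $0$; $\hat g(x,a)=g(x)$ if $x\in E,a=1$, else $0$. $\hat H_n$: histories $\hat h_n=(x_0,a_0,t_1,x_1,\dots,a_{n-1},t_n,x_n)$ with $a_m\in A(x_m)$. A deterministic policy $\pi=\{d_n\}$ consists of measurable $d_n:\mathbb{R}\times\hat H_n\to A$ with $d_n(s,\hat h_n)\in A(x_n)$; on $\hat\Omega=(\hat E\times A\times\mathbb{R}_+)^\infty$ with coordinates $\hat X_n,A_n,\hat T_{n+1}$, $\hat T_0=0$, $\hat S_n=\sum_{m\le n}\hat T_m$, $\hat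 Y_n=(\hat X_0,A_0,\hat T_1,\dots,\hat T_n,\hat X_n)$, $\hat{\mathbb{P}}^\pi_{(s,x)}$ is the unique probability with $\hat X_0=x$, $\hat T_0=0$ a.s., $A_n=d_n(s-\hat S_n,\hat Y_n)$ a.s., and $\hat{\mathbb{P}}^\pi_{(s,x)}(\hat T_{n+1}\le t,\hat X_{n+1}\in B\mid\hat Y_n,A_n)=\hat Q_T(t,B\mid\hat X_n,A_n)$; $\hat X(t)=\hat X_n$, $A(t)=A_n$ for $\hat S_n\le t<\hat S_{n+1}$; $U^\pi(s,x)=\hat{\mathbb{E}}^\pi_{(s,x)}\big[\int_0^s\hat c(\hat X(t),A(t))\,dt+\hat g(\hat X(s),A(s))\big]$. $H^0_n=E\times(\{0\}\times\mathbb{R}_+\times E)^n\subset\hat H_n$. Induced policy of a stopping time $\tau$: $B^\tau_n=\{Y_n(\omega):\omega\in\{\tau=n\}\}$; $d^\tau_n(s,\hat h_n)=\mathbf{1}_{B^\tau_n}(x_0,t_1,x_1,\dots,t_n,x_n)\mathbf{1}_{(0,\infty)}(s)$ if $\hat h_n\in H^0_n$, and $1$ if $\hat h_n\in\hat H_n\setminus H^0_n$. Induced stopping time of a deterministic policy $\pi=\{d_n\}$ and $s\in\mathbb{R}$: with $Y^0_n=(X_0,0,T_1,X_1,\dots,0,T_n,X_n)$, $\tau^s_\pi(\omega)=\inf\{n\in\mathbb{N}:d_n(s-S_n(\omega),Y^0_n(\omega))=1\}$, $\inf\emptyset=+\infty$. *)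

theory Defs
  imports "HOL-Probability.Probability"
begin

text \<open>Q t B x stands for Q(t,B | x); E is given by the measurable space ME (space ME = E).\<close>

definition semi_markov_kernel :: "'e measure \<Rightarrow> (real \<Rightarrow> 'e set \<Rightarrow> 'e \<Rightarrow> real) \<Rightarrow> bool" where
  "semi_markov_kernel ME Q \<longleftrightarrow>
     (\<forall>B\<in>sets ME. \<forall>x\<in>space ME.
        mono_on {0..} (\<lambda>t. Q t B x) \<and>
        (\<forall>t\<ge>0. continuous (at_right t) (\<lambda>t. Q t B x)) \<and>
        Q 0 B x = 0) \<and>
     (\<forall>t\<ge>0. \<forall>B\<in>sets ME. (\<lambda>x. Q t B x) \<in> borel_measurable ME) \<and>
     (\<forall>t\<ge>0. \<forall>x\<in>space ME. \<exists>\<mu>. subprob_space \<mu> \<and> sets \<mu> = sets ME \<and>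
        (\<forall>B\<in>sets ME. Q t B x = measure \<mu> B)) \<and>
     (\<forall>x\<in>space ME. \<exists>\<mu>. prob_space \<mu> \<and> sets \<mu> = sets ME \<and>
        (\<forall>B\<in>sets ME. ((\<lambda>t. Q t B x) \<longlongrightarrow> measure \<mu> B) at_top))"

text \<open>Omega = E x (R+ x E)^N; omega = (x0, w) with w m = (t_(m+1), x_(m+1)).\<close>

type_synonym 'e omega = "'e \<times> (nat \<Rightarrow> real \<times> 'e)"

definition Rplus :: "real measure" where
  "Rplus = restrict_space borel {0..}"

definition Omega_M :: "'e measure \<Rightarrow> 'e omega measure" where
  "Omega_M ME = ME \<Otimes>\<^sub>M (\<Pi>\<^sub>M n\<in>UNIV. Rplus \<Otimes>\<^sub>M ME)"

definition Xs :: "nat \<Rightarrow> 'e omega \<Rightarrow> 'e" where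
  "Xs n \<omega> = (case n of 0 \<Rightarrow> fst \<omega> | Suc m \<Rightarrow> snd (snd \<omega> m))"

definition Ts :: "nat \<Rightarrow> 'e omega \<Rightarrow> real" where
  "Ts n \<omega> = (case n of 0 \<Rightarrow> 0 | Suc m \<Rightarrow> fst (snd \<omega> m))"

definition Ss :: "nat \<Rightarrow> 'e omega \<Rightarrow> real" where
  "Ss n \<omega> = (\<Sum>k\<le>n. Ts k \<omega>)"

text \<open>Y_n = (X_0, T_1, X_1, ..., T_n, X_n).\<close>
definition Ys :: "nat \<Rightarrow> 'e omega \<Rightarrow> 'e \<times> (nat \<Rightarrow> real \<times> 'e)" where
  "Ys n \<omega> = (fst \<omega>, restrict (snd \<omega>) {..<n})"

definition Hist_M :: "'e measure \<Rightarrow> nat \<Rightarrow> ('e \<times> (nat \<Rightarrow> real \<times> 'e)) measure" where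
  "Hist_M ME n = ME \<Otimes>\<^sub>M (\<Pi>\<^sub>M m\<in>{..<n}. Rplus \<Otimes>\<^sub>M ME)"

definition Filt :: "'e measure \<Rightarrow> nat \<Rightarrow> 'e omega measure" where
  "Filt ME n = vimage_algebra (space (Omega_M ME)) (Ys n) (Hist_M ME n)"

definition stopping_time_smp :: "'e measure \<Rightarrow> ('e omega \<Rightarrow> enat) \<Rightarrow> bool" where
  "stopping_time_smp ME \<tau> \<longleftrightarrow> (\<forall>n. {\<omega>\<in>space (Omega_M ME). \<tau> \<omega> = enat n} \<in> sets (Filt ME n))"

text \<open>P is a law P_x of the SMP started at x: P_x(T_0=0, X_0=x)=1 and
  P_x(T_(n+1) \<le> t, X_(n+1) \<in> B | Y_n) = Q(t,B | X_n), the conditional probability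
  written out by its defining property.\<close>
definition smp_measure :: "'e measure \<Rightarrow> (real \<Rightarrow> 'e set \<Rightarrow> 'e \<Rightarrow> real) \<Rightarrow> 'e \<Rightarrow> 'e omega measure \<Rightarrow> bool" where
  "smp_measure ME Q x P \<longleftrightarrow> prob_space P \<and> sets P = sets (Omega_M ME) \<and>
     (AE \<omega> in P. Ts 0 \<omega> = 0 \<and> Xs 0 \<omega> = x) \<and>
     (\<forall>n. \<forall>t\<ge>0. \<forall>B\<in>sets ME. \<forall>C\<in>sets (Filt ME n).
        measure P ({\<omega>\<in>space P. Ts (Suc n) \<omega> \<le> t \<and> Xs (Suc n) \<omega> \<in> B} \<inter> C)
          = set_lebesgue_integral P C (\<lambda>\<omega>. Q t B (Xs n \<omega>)))"

definition Xt :: "real \<Rightarrow> 'e omega \<Rightarrow> 'e" where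
  "Xt t \<omega> = Xs (THE n. Ss n \<omega> \<le> t \<and> t < Ss (Suc n) \<omega>) \<omega>"

definition Stau :: "('e omega \<Rightarrow> enat) \<Rightarrow> 'e omega \<Rightarrow> ereal" where
  "Stau \<tau> \<omega> = (case \<tau> \<omega> of enat n \<Rightarrow> ereal (Ss n \<omega>) | \<infinity> \<Rightarrow> (SUP n. ereal (Ss n \<omega>)))"

definition reward :: "('e \<Rightarrow> real) \<Rightarrow> ('e \<Rightarrow> real) \<Rightarrow> ('e omega \<Rightarrow> enat) \<Rightarrow> real \<Rightarrow> 'e omega \<Rightarrow> ennreal" where
  "reward c g \<tau> s \<omega> =
     (if Stau \<tau> \<omega> < ereal s then
        (\<integral>\<^sup>+ t. ennreal (c (Xt t \<omega>)) * indicator {0..real_of_ereal (Stau \<tau> \<omega>)} t \<partial>lborel)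
          + ennreal (g (Xt (real_of_ereal (Stau \<tau> \<omega>)) \<omega>))
      else (\<integral>\<^sup>+ t. ennreal (c (Xt t \<omega>)) * indicator {0..s} t \<partial>lborel))"

definition Vval :: "('e \<Rightarrow> 'e omega measure) \<Rightarrow> ('e \<Rightarrow> real) \<Rightarrow> ('e \<Rightarrow> real) \<Rightarrow> ('e omega \<Rightarrow> enat) \<Rightarrow> real \<Rightarrow> 'e \<Rightarrow> ennreal" where
  "Vval P c g \<tau> s x = (\<integral>\<^sup>+ \<omega>. reward c g \<tau> s \<omega> \<partial>(P x))"

text \<open>E-hat = E \<union> {Delta} with Delta = None; A = {0,1}.
  omega-hat n = (X-hat_n, A_n, T-hat_(n+1)).
  A history h-hat_n is encoded as (h, x_n) with h m = (x_m, a_m, t_(m+1)) for m < n.\<close>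

type_synonym 'e homega = "nat \<Rightarrow> 'e option \<times> nat \<times> real"
type_synonym 'e hhist = "(nat \<Rightarrow> 'e option \<times> nat \<times> real) \<times> 'e option"

definition Ehat_M :: "'e measure \<Rightarrow> 'e option measure" where
  "Ehat_M ME = sigma (insert None (Some ` space ME)) (insert {None} ((`) Some ` sets ME))"

definition A_M :: "nat measure" where
  "A_M = count_space {0, 1}"

definition Acts :: "'e option \<Rightarrow> nat set" where
  "Acts x = (if x = None then {1} else {0, 1})"

definition Omegahat_M :: "'e measure \<Rightarrow> 'e homega measure" where
  "Omegahat_M ME = (\<Pi>\<^sub>M n\<in>UNIV. Ehat_M ME \<Otimes>\<^sub>M A_M \<Otimes>\<^sub>M Rplus)"

definition Xh :: "nat \<Rightarrow> 'e homega \<Rightarrow> 'e option" where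
  "Xh n \<omega> = fst (\<omega> n)"

definition Ah :: "nat \<Rightarrow> 'e homega \<Rightarrow> nat" where
  "Ah n \<omega> = fst (snd (\<omega> n))"

definition Th :: "nat \<Rightarrow> 'e homega \<Rightarrow> real" where
  "Th n \<omega> = (case n of 0 \<Rightarrow> 0 | Suc m \<Rightarrow> snd (snd (\<omega> m)))"

definition Sh :: "nat \<Rightarrow> 'e homega \<Rightarrow> real" where
  "Sh n \<omega> = (\<Sum>k\<le>n. Th k \<omega>)"

definition Yh :: "nat \<Rightarrow> 'e homega \<Rightarrow> 'e hhist" where
  "Yh n \<omega> = (restrict \<omega> {..<n}, Xh n \<omega>)"

definition HistH_M :: "'e measure \<Rightarrow> nat \<Rightarrow> 'e hhist measure" where
  "HistH_M ME n = (\<Pi>\<^sub>M m\<in>{..<n}. Ehat_M ME \<Otimes>\<^sub>M A_M \<Otimes>\<^sub>M Rplus) \<Otimes>\<^sub>M Ehat_M ME"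

definition FiltA :: "'e measure \<Rightarrow> nat \<Rightarrow> 'e homega measure" where
  "FiltA ME n = vimage_algebra (space (Omegahat_M ME)) (\<lambda>\<omega>. (Yh n \<omega>, Ah n \<omega>)) (HistH_M ME n \<Otimes>\<^sub>M A_M)"

text \<open>Q-hat_T(t,B | x,a). For x \<in> E, a = 0: Q(t, B - {Delta} | x); for a = 1:
  1_[T+1,\<infinity>)(t) delta_Delta(B). The pair (Delta, 0) is not admissible; its value is irrelevant
  (it is put in the second branch).\<close>
definition Qhat :: "real \<Rightarrow> (real \<Rightarrow> 'e set \<Rightarrow> 'e \<Rightarrow> real) \<Rightarrow> real \<Rightarrow> 'e option set \<Rightarrow> 'e option \<Rightarrow> nat \<Rightarrow> real" where
  "Qhat T Q t B x a = (if x \<noteq> None \<and> a = 0 then Q t {y. Some y \<in> B} (the x)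
                       else indicator {T + 1..} t * indicator B None)"

definition chat :: "('e \<Rightarrow> real) \<Rightarrow> 'e option \<Rightarrow> nat \<Rightarrow> real" where
  "chat c x a = (if x \<noteq> None \<and> a = 0 then c (the x) else 0)"

definition ghat :: "('e \<Rightarrow> real) \<Rightarrow> 'e option \<Rightarrow> nat \<Rightarrow> real" where
  "ghat g x a = (if x \<noteq> None \<and> a = 1 then g (the x) else 0)"

text \<open>P-hat^pi_(s,x) for the deterministic policy d (d n s h = d_n(s, h)).\<close>
definition smdp_measure :: "'e measure \<Rightarrow> real \<Rightarrow> (real \<Rightarrow> 'e set \<Rightarrow> 'e \<Rightarrow> real)
    \<Rightarrow> (nat \<Rightarrow> real \<Rightarrow> 'e hhist \<Rightarrow> nat) \<Rightarrow> real \<Rightarrow> 'e option \<Rightarrow> 'e homega measure \<Rightarrow> bool" where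
  "smdp_measure ME T Q d s x P \<longleftrightarrow> prob_space P \<and> sets P = sets (Omegahat_M ME) \<and>
     (AE \<omega> in P. Xh 0 \<omega> = x) \<and>
     (\<forall>n. AE \<omega> in P. Ah n \<omega> = d n (s - Sh n \<omega>) (Yh n \<omega>)) \<and>
     (\<forall>n. \<forall>t\<ge>0. \<forall>B\<in>sets (Ehat_M ME). \<forall>C\<in>sets (FiltA ME n).
        measure P ({\<omega>\<in>space P. Th (Suc n) \<omega> \<le> t \<and> Xh (Suc n) \<omega> \<in> B} \<inter> C)
          = set_lebesgue_integral P C (\<lambda>\<omega>. Qhat T Q t B (Xh n \<omega>) (Ah n \<omega>)))"

definition Xht :: "real \<Rightarrow> 'e homega \<Rightarrow> 'e option" where
  "Xht t \<omega> = Xh (THE n. Sh n \<omega> \<le> t \<and> t < Sh (Suc n) \<omega>) \<omega>"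

definition Aht :: "real \<Rightarrow> 'e homega \<Rightarrow> nat" where
  "Aht t \<omega> = Ah (THE n. Sh n \<omega> \<le> t \<and> t < Sh (Suc n) \<omega>) \<omega>"

text \<open>U^pi(s,x), where Ph s x is P-hat^pi_(s,x).\<close>
definition Uval :: "(real \<Rightarrow> 'e \<Rightarrow> 'e homega measure) \<Rightarrow> ('e \<Rightarrow> real) \<Rightarrow> ('e \<Rightarrow> real) \<Rightarrow> real \<Rightarrow> 'e \<Rightarrow> ennreal" where
  "Uval Ph c g s x = (\<integral>\<^sup>+ \<omega>.
      (\<integral>\<^sup>+ t. ennreal (chat c (Xht t \<omega>) (Aht t \<omega>)) * indicator {0..s} t \<partial>lborel)
        + ennreal (ghat g (Xht s \<omega>) (Aht s \<omega>)) \<partial>(Ph s x))"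

definition Btau :: "'e measure \<Rightarrow> ('e omega \<Rightarrow> enat) \<Rightarrow> nat \<Rightarrow> ('e \<times> (nat \<Rightarrow> real \<times> 'e)) set" where
  "Btau ME \<tau> n = Ys n ` {\<omega>\<in>space (Omega_M ME). \<tau> \<omega> = enat n}"

definition H0 :: "'e measure \<Rightarrow> nat \<Rightarrow> 'e hhist set" where
  "H0 ME n = {(h, xn). h \<in> extensional {..<n} \<and>
       (\<forall>m<n. fst (h m) \<in> Some ` space ME \<and> fst (snd (h m)) = 0 \<and> snd (snd (h m)) \<ge> 0) \<and>
       xn \<in> Some ` space ME}"

text \<open>(x_0,0,t_1,x_1,...,0,t_n,x_n) \<mapsto> (x_0,t_1,x_1,...,t_n,x_n).\<close>
definition h0_to_hist :: "nat \<Rightarrow> 'e hhist \<Rightarrow> 'e \<times> (nat \<Rightarrow> real \<times> 'e)" where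
  "h0_to_hist n hx = (let h = fst hx; xn = snd hx;
       xx = (\<lambda>m. if m < n then fst (h m) else xn)
     in (the (xx 0), \<lambda>m\<in>{..<n}. (snd (snd (h m)), the (xx (Suc m)))))"

definition d_tau :: "'e measure \<Rightarrow> ('e omega \<Rightarrow> enat) \<Rightarrow> nat \<Rightarrow> real \<Rightarrow> 'e hhist \<Rightarrow> nat" where
  "d_tau ME \<tau> n s hh =
     (if hh \<in> H0 ME n then
        (if h0_to_hist n hh \<in> Btau ME \<tau> n \<and> s \<in> {0<..} then 1 else 0)
      else 1)"

definition Y0 :: "nat \<Rightarrow> 'e omega \<Rightarrow> 'e hhist" where
  "Y0 n \<omega> = ((\<lambda>m\<in>{..<n}. (Some (Xs m \<omega>), 0, Ts (Suc m) \<omega>)), Some (Xs n \<omega>))"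

definition tau_pi :: "(nat \<Rightarrow> real \<Rightarrow> 'e hhist \<Rightarrow> nat) \<Rightarrow> real \<Rightarrow> 'e omega \<Rightarrow> enat" where
  "tau_pi d s \<omega> = (if \<exists>n. d n (s - Ss n \<omega>) (Y0 n \<omega>) = 1
                    then enat (LEAST n. d n (s - Ss n \<omega>) (Y0 n \<omega>) = 1) else \<infinity>)"

end

theory Submission
  imports Defs
begin

text \<open>Stop an SMP path at \<open>\<tau>\<close>, provided \<open>S\<^sub>\<tau> < s\<close>: before that jump every action is 0, at it
  the action becomes 1, and from the next jump on the path sits in \<open>\<Delta>\<close> with holding times
  \<open>T + 1\<close>. This measurable map sends \<open>P\<^sub>x\<close> to a measure with the defining properties of the law of
  the decision process under the induced policy. By induction over the histories those properties
  determine the law, so the two coincide. The kernel condition makes the jump times increase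
  strictly to infinity almost surely; on such a path the reward of the stopped path up to \<open>s\<close> is
  the stopping reward, because the first absorbing holding time already exceeds \<open>s \<le> T\<close>. The
  stopping time induced by the policy is \<open>\<tau>\<close> on \<open>{S\<^sub>\<tau> < s}\<close> and infinite elsewhere, where
  both rewards only see the running cost up to \<open>s\<close>.\<close>

section \<open>Measurability\<close>

text \<open>Neither law is constructed: \<open>P x\<close> and \<open>Ph s x\<close> are arbitrary
  measures with the prescribed conditional laws, and they live on different path spaces. A pathwise
  identity alone therefore says nothing about the expectations, which forces the pushforward and the
  uniqueness argument. The stopping rule sees states and times, the policy sees actions as well.
  They meet because a history with only zero actions carries exactly the information of
  \<open>Ys n\<close>, while a recorded action 1 takes a history out of \<open>H0\<close>, after
  which the policy keeps choosing 1. The stop is defined by a strict inequality because the policy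
  tests the remaining time s - S_n against the open half line: a tie S_tau = s pays no terminal
  reward in either model. Current states are definite descriptions of a jump index, which are
  meaningful on all of [0,s] only if the jump times pass s, so explosive paths have to be discarded
  as a null set. Stopping leaves one discrepancy, the running cost at the single instant S_tau, and
  a point is Lebesgue null.\<close>

abbreviation Step_M :: "'e measure \<Rightarrow> ('e option \<times> nat \<times> real) measure" where
  "Step_M ME \<equiv> Ehat_M ME \<Otimes>\<^sub>M A_M \<Otimes>\<^sub>M Rplus"

text \<open>A total substitute for \<open>the\<close>: the value of \<open>the None\<close> is
  unspecified and may lie outside E, whereas a default in E gives a measurable map into
  \<open>ME\<close>.\<close>

definition the_or :: "'e \<Rightarrow> 'e option \<Rightarrow> 'e" where
  "the_or x0 y = (case y of None \<Rightarrow> x0 | Some x \<Rightarrow> x)"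

lemma the_or_simps [simp]: "the_or x0 None = x0" "the_or x0 (Some x) = x"
  by (auto simp: the_or_def)

section \<open>The state space extended by the cemetery\<close>

lemma space_Ehat_M [simp]: "space (Ehat_M ME) = insert None (Some ` space ME)"
  and sets_Ehat_M_sigma: "sets (Ehat_M ME) =
    sigma_sets (insert None (Some ` space ME)) (insert {None} ((`) Some ` sets ME))"
proof -
  have "insert {None} ((`) Some ` sets ME) \<subseteq> Pow (insert None (Some ` space ME))"
    using sets.sets_into_space by auto
  then show "space (Ehat_M ME) = insert None (Some ` space ME)"
    "sets (Ehat_M ME) = sigma_sets (insert None (Some ` space ME)) (insert {None} ((`) Some ` sets ME))"
    by (simp_all add: Ehat_M_def space_measure_of_conv sets_measure_of)
qed

lemma measurable_Some [measurable]: "Some \<in> ME \<rightarrow>\<^sub>M Ehat_M ME"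
  unfolding Ehat_M_def
proof (rule measurable_measure_of)
  show "insert {None} ((`) Some ` sets ME) \<subseteq> Pow (insert None (Some ` space ME))"
    using sets.sets_into_space by auto
  show "Some \<in> space ME \<rightarrow> insert None (Some ` space ME)"
    by (rule Pi_I) simp
  fix A assume "A \<in> insert {None} ((`) Some ` sets ME)"
  then consider "A = {None}" | B where "A = Some ` B" "B \<in> sets ME"
    by blast
  then show "Some -` A \<inter> space ME \<in> sets ME"
  proof cases
    case 2
    moreover have "Some -` Some ` B = B" by auto
    ultimately show ?thesis by simp
  next
    case 1
    then show ?thesis by (simp add: vimage_def)
  qed
qed

text \<open>Preimages under \<open>Some\<close> give one direction; conversely such a B is the image
  of its trace on E, with or without the isolated point \<open>None\<close>. Membership in the
  generated sigma-algebra thus becomes a condition on the trace.\<close>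

lemma sets_Ehat_M_iff:
  "B \<in> sets (Ehat_M ME) \<longleftrightarrow> B \<subseteq> space (Ehat_M ME) \<and> {y. Some y \<in> B} \<in> sets ME"
proof
  assume B: "B \<in> sets (Ehat_M ME)"
  then have sub: "B \<subseteq> space (Ehat_M ME)"
    by (rule sets.sets_into_space)
  have "Some -` B \<inter> space ME = {y. Some y \<in> B}"
    using sub by auto
  then show "B \<subseteq> space (Ehat_M ME) \<and> {y. Some y \<in> B} \<in> sets ME"
    using sub measurable_sets[OF measurable_Some B] by auto
next
  assume B: "B \<subseteq> space (Ehat_M ME) \<and> {y. Some y \<in> B} \<in> sets ME"
  have 1: "{None} \<in> sets (Ehat_M ME)"
    by (auto simp: sets_Ehat_M_sigma)
  have 2: "Some ` {y. Some y \<in> B} \<in> sets (Ehat_M ME)"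
    using B by (auto simp: sets_Ehat_M_sigma)
  have "B = (if None \<in> B then Some ` {y. Some y \<in> B} \<union> {None} else Some ` {y. Some y \<in> B})"
    using B by (auto simp: image_iff)
  then show "B \<in> sets (Ehat_M ME)"
    using 2 sets.Un[OF 2 1] by (simp split: if_splits)
qed

lemma pred_None_Ehat_M [measurable]: "Measurable.pred (Ehat_M ME) (\<lambda>y. y = None)"
proof -
  have "{y \<in> space (Ehat_M ME). y = None} = {None}" by auto
  then show ?thesis by (simp add: pred_def sets_Ehat_M_iff)
qed

lemma measurable_the_or [measurable]:
  assumes "x0 \<in> space ME" shows "the_or x0 \<in> Ehat_M ME \<rightarrow>\<^sub>M ME"
proof (rule measurableI)
  show "the_or x0 y \<in> space ME" if "y \<in> space (Ehat_M ME)" for y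
    using that assms by auto
  fix A assume A: "A \<in> sets ME"
  have "{y. Some y \<in> the_or x0 -` A \<inter> space (Ehat_M ME)} = A"
    using sets.sets_into_space[OF A] by auto
  then show "the_or x0 -` A \<inter> space (Ehat_M ME) \<in> sets (Ehat_M ME)"
    using A by (auto simp: sets_Ehat_M_iff)
qed

lemma space_Rplus [simp]: "space Rplus = {0..}"
  by (simp add: Rplus_def)

lemma measurable_RplusD: "f \<in> M \<rightarrow>\<^sub>M Rplus \<Longrightarrow> f \<in> borel_measurable M"
  by (simp add: Rplus_def measurable_restrict_space2_iff)

lemma measurable_A_M_iff: "f \<in> M \<rightarrow>\<^sub>M A_M \<longleftrightarrow> f \<in> M \<rightarrow>\<^sub>M count_space UNIV \<and> f \<in> space M \<rightarrow> {0, 1}"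
  unfolding A_M_def
  using measurable_restrict_space2_iff[of f M "count_space UNIV" "{0, 1}"]
  by (simp add: restrict_count_space)

lemma measurable_A_MD: "f \<in> M \<rightarrow>\<^sub>M A_M \<Longrightarrow> f \<in> M \<rightarrow>\<^sub>M count_space UNIV"
  by (simp add: measurable_A_M_iff)

lemma space_A_M [simp]: "space A_M = {0, 1}"
  by (simp add: A_M_def)

section \<open>Coordinates of the decision process\<close>

lemma measurable_Xh [measurable]: "Xh n \<in> Omegahat_M ME \<rightarrow>\<^sub>M Ehat_M ME"
  unfolding Xh_def Omegahat_M_def by measurable

lemma measurable_Ah [measurable]: "Ah n \<in> Omegahat_M ME \<rightarrow>\<^sub>M A_M"
  unfolding Ah_def Omegahat_M_def by measurable

lemma measurable_Th_Suc [measurable]: "Th (Suc n) \<in> Omegahat_M ME \<rightarrow>\<^sub>M Rplus"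
  unfolding Th_def Omegahat_M_def by simp measurable

lemma measurable_Th [measurable]:
  fixes ME :: "'e measure" shows "Th n \<in> borel_measurable (Omegahat_M ME)"
proof (cases n)
  case 0
  have "(Th 0 :: 'e homega \<Rightarrow> real) = (\<lambda>\<omega>. 0)" by (simp add: Th_def fun_eq_iff)
  then show ?thesis unfolding 0 by simp
next
  case (Suc m)
  show ?thesis unfolding Suc by (rule measurable_RplusD[OF measurable_Th_Suc])
qed

lemma measurable_Sh [measurable]: "Sh n \<in> borel_measurable (Omegahat_M ME)"
  unfolding Sh_def by measurable

lemma measurable_Yh [measurable]: "Yh n \<in> Omegahat_M ME \<rightarrow>\<^sub>M HistH_M ME n"
  unfolding Yh_def HistH_M_def
proof (rule measurable_Pair)
  show "(\<lambda>\<omega>. restrict \<omega> {..<n}) \<in> Omegahat_M ME \<rightarrow>\<^sub>M Pi\<^sub>M {..<n} (\<lambda>m. Step_M ME)"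
    unfolding Omegahat_M_def by (rule measurable_restrict_subset) simp
qed measurable

lemma Th_Suc_nonneg: "\<omega> \<in> space (Omegahat_M ME) \<Longrightarrow> 0 \<le> Th (Suc n) \<omega>"
  using measurable_space[OF measurable_Th_Suc, of \<omega> ME n] by simp

section \<open>Coordinates and filtration of the semi-Markov process\<close>

lemma measurable_Xs [measurable]: "Xs n \<in> Omega_M ME \<rightarrow>\<^sub>M ME"
  unfolding Xs_def Omega_M_def by (cases n) (simp, measurable)+

lemma measurable_Ts_Suc [measurable]: "Ts (Suc n) \<in> Omega_M ME \<rightarrow>\<^sub>M Rplus"
  unfolding Ts_def Omega_M_def by simp measurable

lemma Ts_Suc_nonneg: "\<omega> \<in> space (Omega_M ME) \<Longrightarrow> 0 \<le> Ts (Suc n) \<omega>"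
  using measurable_space[OF measurable_Ts_Suc, of \<omega> ME n] by simp

lemma measurable_Ys [measurable]: "Ys n \<in> Omega_M ME \<rightarrow>\<^sub>M Hist_M ME n"
  unfolding Ys_def Hist_M_def
proof (rule measurable_Pair)
  show "(\<lambda>\<omega>. restrict (snd \<omega>) {..<n}) \<in> Omega_M ME \<rightarrow>\<^sub>M Pi\<^sub>M {..<n} (\<lambda>m. Rplus \<Otimes>\<^sub>M ME)"
    unfolding Omega_M_def
    by (rule measurable_compose[OF measurable_snd measurable_restrict_subset]) simp
qed (simp add: Omega_M_def)

lemma space_Filt [simp]: "space (Filt ME n) = space (Omega_M ME)"
  by (simp add: Filt_def)

lemma measurable_Ys_Filt: "Ys n \<in> Filt ME n \<rightarrow>\<^sub>M Hist_M ME n"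
  unfolding Filt_def
  by (rule measurable_vimage_algebra1) (use measurable_space[OF measurable_Ys] in auto)

lemma sets_Filt_subset: "sets (Filt ME n) \<subseteq> sets (Omega_M ME)"
  unfolding Filt_def
  by (subst sets_vimage_algebra2) (use measurable_space[OF measurable_Ys] measurable_sets[OF measurable_Ys] in auto)

text \<open>Truncating the longer history recovers the shorter one, so \<open>Ys m\<close> is a
  measurable function of \<open>Ys n\<close>.\<close>

lemma sets_Filt_mono: assumes "m \<le> n" shows "sets (Filt ME m) \<subseteq> sets (Filt ME n)"
proof -
  have "(\<lambda>h. (fst h, restrict (snd h) {..<m})) \<in> Hist_M ME n \<rightarrow>\<^sub>M Hist_M ME m"
    unfolding Hist_M_def
    by (intro measurable_Pair measurable_fst measurable_compose[OF measurable_snd measurable_restrict_subset])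
      (use assms in auto)
  from measurable_compose[OF measurable_Ys_Filt this]
  have "(\<lambda>\<omega>. (fst (Ys n \<omega>), restrict (snd (Ys n \<omega>)) {..<m})) \<in> Filt ME n \<rightarrow>\<^sub>M Hist_M ME m" .
  moreover have "(\<lambda>\<omega>. (fst (Ys n \<omega>), restrict (snd (Ys n \<omega>)) {..<m})) = Ys m"
    using assms by (auto simp: Ys_def fun_eq_iff restrict_def)
  ultimately have Y: "Ys m \<in> Filt ME n \<rightarrow>\<^sub>M Hist_M ME m" by (rule back_subst)
  show ?thesis
    unfolding Filt_def[of ME m]
    by (subst sets_vimage_algebra2) (use measurable_space[OF measurable_Ys] measurable_sets[OF Y] in auto)
qed

lemma measurable_Filt_mono: "f \<in> Filt ME m \<rightarrow>\<^sub>M N \<Longrightarrow> m \<le> n \<Longrightarrow> f \<in> Filt ME n \<rightarrow>\<^sub>M N"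
  using sets_Filt_mono[of m n ME] by (auto simp: measurable_def)

lemma measurable_Filt_OmegaD: "f \<in> Filt ME m \<rightarrow>\<^sub>M N \<Longrightarrow> f \<in> Omega_M ME \<rightarrow>\<^sub>M N"
  using sets_Filt_subset[of ME m] by (auto simp: measurable_def)

lemma measurable_Xs_Filt_self:
  fixes ME :: "'e measure" shows "Xs n \<in> Filt ME n \<rightarrow>\<^sub>M ME"
proof (cases n)
  case 0
  have "(\<lambda>\<omega>. fst (Ys 0 \<omega>)) \<in> Filt ME 0 \<rightarrow>\<^sub>M ME"
    by (rule measurable_compose[OF measurable_Ys_Filt]) (simp add: Hist_M_def)
  moreover have "(\<lambda>\<omega>. fst (Ys 0 \<omega>)) = (Xs 0 :: 'e omega \<Rightarrow> 'e)" by (simp add: Ys_def Xs_def fun_eq_iff)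
  ultimately show ?thesis unfolding 0 by simp
next
  case (Suc m)
  have "(\<lambda>h. snd (snd h m)) \<in> Hist_M ME n \<rightarrow>\<^sub>M ME"
    unfolding Hist_M_def Suc by measurable
  from measurable_compose[OF measurable_Ys_Filt this]
  have "(\<lambda>\<omega>. snd (snd (Ys n \<omega>) m)) \<in> Filt ME n \<rightarrow>\<^sub>M ME" .
  moreover have "(\<lambda>\<omega>. snd (snd (Ys n \<omega>) m)) = (Xs n :: 'e omega \<Rightarrow> 'e)" by (simp add: Suc Ys_def Xs_def fun_eq_iff)
  ultimately show ?thesis by simp
qed

lemma measurable_Xs_Filt [measurable (raw)]: "m \<le> n \<Longrightarrow> Xs m \<in> Filt ME n \<rightarrow>\<^sub>M ME"
  by (rule measurable_Filt_mono[OF measurable_Xs_Filt_self])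

lemma measurable_Ts_Filt [measurable (raw)]:
  fixes ME :: "'e measure"
  assumes "Suc m \<le> n" shows "Ts (Suc m) \<in> Filt ME n \<rightarrow>\<^sub>M Rplus"
proof (rule measurable_Filt_mono[OF _ assms])
  have "(\<lambda>h. fst (snd h m)) \<in> Hist_M ME (Suc m) \<rightarrow>\<^sub>M Rplus"
    unfolding Hist_M_def by measurable
  from measurable_compose[OF measurable_Ys_Filt this]
  have "(\<lambda>\<omega>. fst (snd (Ys (Suc m) \<omega>) m)) \<in> Filt ME (Suc m) \<rightarrow>\<^sub>M Rplus" .
  moreover have "(\<lambda>\<omega>. fst (snd (Ys (Suc m) \<omega>) m)) = (Ts (Suc m) :: 'e omega \<Rightarrow> real)" by (simp add: Ys_def Ts_def fun_eq_iff)
  ultimately show "Ts (Suc m) \<in> Filt ME (Suc m) \<rightarrow>\<^sub>M Rplus" by simp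
qed

lemma measurable_Ss_Filt [measurable (raw)]:
  fixes ME :: "'e measure"
  assumes "m \<le> n" shows "Ss m \<in> borel_measurable (Filt ME n)"
  unfolding Ss_def
proof (rule borel_measurable_sum)
  fix k assume k: "k \<in> {..m}"
  show "Ts k \<in> borel_measurable (Filt ME n)"
  proof (cases k)
    case 0
    have "(Ts 0 :: 'e omega \<Rightarrow> real) = (\<lambda>\<omega>. 0)" by (simp add: Ts_def fun_eq_iff)
    then show ?thesis unfolding 0 by simp
  next
    case (Suc l)
    with k assms have "Ts k \<in> Filt ME n \<rightarrow>\<^sub>M Rplus"
      by (auto intro: measurable_Ts_Filt)
    then show ?thesis by (rule measurable_RplusD)
  qed
qed

lemma stopping_sets:
  assumes "stopping_time_smp ME \<tau>" "m \<le> n"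
  shows "{\<omega> \<in> space (Omega_M ME). \<tau> \<omega> = enat m} \<in> sets (Filt ME n)"
proof -
  have "{\<omega> \<in> space (Omega_M ME). \<tau> \<omega> = enat m} \<in> sets (Filt ME m)"
    using assms(1) by (simp add: stopping_time_smp_def)
  then show ?thesis
    using sets_Filt_mono[OF assms(2), of ME] by (rule rev_subsetD)
qed

section \<open>Uniqueness of the law of the decision process\<close>

lemma measure_eqI_rectangles:
  assumes "finite_measure M" and M: "sets M = sets (A \<Otimes>\<^sub>M B)" and N: "sets N = sets (A \<Otimes>\<^sub>M B)"
    and eq: "\<And>a b. a \<in> sets A \<Longrightarrow> b \<in> sets B \<Longrightarrow> emeasure M (a \<times> b) = emeasure N (a \<times> b)"
  shows "M = N"
proof (rule measure_eqI_generator_eq[OF Int_stable_pair_measure_generator[of A B] pair_measure_closed])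
  interpret finite_measure M by fact
  show "range (\<lambda>_::nat. space A \<times> space B) \<subseteq> {a \<times> b |a b. a \<in> sets A \<and> b \<in> sets B}"
    by auto
  show "emeasure M (space A \<times> space B) \<noteq> \<infinity>"
    by simp
  fix X assume "X \<in> {a \<times> b |a b. a \<in> sets A \<and> b \<in> sets B}"
  then show "emeasure M X = emeasure N X"
    using eq by blast
qed (simp_all add: M N sets_pair_measure[symmetric])

text \<open>The defining property of the process tests a holding time only through the events that
  it is at most t, with t nonnegative; these intervals are closed under intersection and generate
  \<open>Rplus\<close>.\<close>

lemma measure_eqI_Rplus:
  assumes "finite_measure M" and M: "sets M = sets Rplus" and N: "sets N = sets Rplus"
    and eq: "\<And>t. 0 \<le> t \<Longrightarrow> emeasure M {0..t} = emeasure N {0..t}"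
  shows "M = N"
proof (rule measure_eqI_generator_eq[where \<Omega> = "{0..}" and E = "(\<lambda>t. {0..t}) ` {0..}"
      and A = "\<lambda>n. {0..real n}"])
  interpret finite_measure M by fact
  show "Int_stable ((\<lambda>t. {0..t}) ` {0::real..})"
  proof (rule Int_stableI)
    fix a b :: "real set"
    assume "a \<in> (\<lambda>t. {0..t}) ` {0..}" "b \<in> (\<lambda>t. {0..t}) ` {0..}"
    then obtain x y where "a = {0..x}" "b = {0..y}" "0 \<le> x" "0 \<le> y" by auto
    then have "a \<inter> b = {0..min x y}" "0 \<le> min x y" by auto
    then show "a \<inter> b \<in> (\<lambda>t. {0..t}) ` {0..}" by auto
  qed
  have borel: "sets (borel :: real measure) = sigma_sets UNIV (range (\<lambda>a. {..a}))"
    by (subst borel_eq_atMost) simp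
  have "sets Rplus = sigma_sets {0..} ((\<inter>) {0..} ` range (\<lambda>a::real. {..a}))"
    unfolding Rplus_def sets_restrict_space borel
    by (rule sigma_sets_Int) (simp_all add: borel[symmetric])
  \<comment> \<open>A ray with a negative endpoint has an empty trace on the half line; every other
    trace is an interval from 0.\<close>
  also have "\<dots> = sigma_sets {0..} ((\<lambda>t. {0..t}) ` {0::real..})"
  proof (rule sigma_sets_eqI)
    fix a :: "real set" assume "a \<in> (\<inter>) {0..} ` range (\<lambda>a. {..a})"
    then obtain x where x: "a = {..x} \<inter> {0..}" by auto
    show "a \<in> sigma_sets {0..} ((\<lambda>t. {0..t}) ` {0..})"
    proof (cases "0 \<le> x")
      case True
      have "a = {0..x}" using x by auto
      then show ?thesis using True by (intro sigma_sets.Basic) auto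
    next
      case False
      then have "a = {}" using x by auto
      then show ?thesis by (simp add: sigma_sets.Empty)
    qed
  next
    fix b :: "real set" assume "b \<in> (\<lambda>t. {0..t}) ` {0..}"
    then obtain x where x: "b = {0..x}" by auto
    have "b = {..x} \<inter> {0..}" using x by auto
    then show "b \<in> sigma_sets {0..} ((\<inter>) {0..} ` range (\<lambda>a. {..a}))"
      by (intro sigma_sets.Basic) auto
  qed
  finally show "sets M = sigma_sets {0..} ((\<lambda>t. {0..t}) ` {0..})"
    "sets N = sigma_sets {0..} ((\<lambda>t. {0..t}) ` {0..})"
    using M N by simp_all
  show "(\<Union>i. {0..real i}) = {0..}"
    by (auto simp: real_arch_simple)
  show "emeasure M {0..real n} \<noteq> \<infinity>" for n
    by simp
qed (use eq in auto)

lemma sets_Icc_Rplus: "{0..t} \<in> sets Rplus"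
  unfolding Rplus_def sets_restrict_space by (rule image_eqI[of _ _ "{..t}"]) auto

text \<open>Fixing one side of a rectangle leaves a measure in the other factor. Together with its
  mirror image below, this lets an equality on special rectangles be extended one factor at a
  time.\<close>

lemma emeasure_restrict_fst:
  assumes M: "sets M = sets (A \<Otimes>\<^sub>M B)" and a: "a \<in> sets A" and b: "b \<in> sets B"
  shows "emeasure (distr (restrict_space M (space A \<times> b)) A fst) a = emeasure M (a \<times> b)"
proof -
  have sp: "space M = space A \<times> space B"
    using sets_eq_imp_space_eq[OF M] by (simp add: space_pair_measure)
  have fst: "fst \<in> M \<rightarrow>\<^sub>M A"
    by (subst measurable_cong_sets[OF M refl]) simp
  have S: "space A \<times> b \<in> sets M" using M b by simp
  have sub: "a \<subseteq> space A" "b \<subseteq> space B" using a b sets.sets_into_space by auto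
  have "fst -` a \<inter> space (restrict_space M (space A \<times> b)) = a \<times> b"
    using sub by (auto simp: space_restrict_space sp)
  moreover have "a \<times> b \<subseteq> space A \<times> b" using sub by auto
  ultimately show ?thesis
    using a S by (simp add: emeasure_distr measurable_restrict_space1[OF fst] emeasure_restrict_space)
qed

lemma emeasure_restrict_snd:
  assumes M: "sets M = sets (A \<Otimes>\<^sub>M B)" and a: "a \<in> sets A" and b: "b \<in> sets B"
  shows "emeasure (distr (restrict_space M (a \<times> space B)) B snd) b = emeasure M (a \<times> b)"
proof -
  have sp: "space M = space A \<times> space B"
    using sets_eq_imp_space_eq[OF M] by (simp add: space_pair_measure)
  have snd: "snd \<in> M \<rightarrow>\<^sub>M B"
    by (subst measurable_cong_sets[OF M refl]) simp
  have S: "a \<times> space B \<in> sets M" using M a by simp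
  have sub: "a \<subseteq> space A" "b \<subseteq> space B" using a b sets.sets_into_space by auto
  have "snd -` b \<inter> space (restrict_space M (a \<times> space B)) = a \<times> b"
    using sub by (auto simp: space_restrict_space sp)
  moreover have "a \<times> b \<subseteq> a \<times> space B" using sub by auto
  ultimately show ?thesis
    using b S by (simp add: emeasure_distr measurable_restrict_space1[OF snd] emeasure_restrict_space)
qed

lemma finite_measure_distr_restrict:
  assumes "finite_measure M" "S \<in> sets M" "f \<in> M \<rightarrow>\<^sub>M N"
  shows "finite_measure (distr (restrict_space M S) N f)"
  using assms by (intro finite_measure.finite_measure_distr finite_measure_restrict_space
      measurable_restrict_space1)

lemma measure_eqI_rectangles_Rplus:
  assumes fin: "finite_measure M" and M: "sets M = sets ((A \<Otimes>\<^sub>M B) \<Otimes>\<^sub>M Rplus)"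
    and N: "sets N = sets ((A \<Otimes>\<^sub>M B) \<Otimes>\<^sub>M Rplus)"
    and eq: "\<And>a b t. a \<in> sets A \<Longrightarrow> b \<in> sets B \<Longrightarrow> 0 \<le> t \<Longrightarrow>
      emeasure M ((a \<times> b) \<times> {0..t}) = emeasure N ((a \<times> b) \<times> {0..t})"
  shows "M = N"
proof (rule measure_eqI_rectangles[OF fin M N])
  have fst: "fst \<in> M \<rightarrow>\<^sub>M A \<Otimes>\<^sub>M B"
    by (subst measurable_cong_sets[OF M refl]) simp
  have snd: "snd \<in> M \<rightarrow>\<^sub>M Rplus"
    by (subst measurable_cong_sets[OF M refl]) simp
  \<comment> \<open>With the time interval fixed, both measures project to measures on the first
    factor that agree on rectangles, hence everywhere.\<close>
  have eq2: "emeasure M (c \<times> {0..t}) = emeasure N (c \<times> {0..t})"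
    if c: "c \<in> sets (A \<Otimes>\<^sub>M B)" and t: "0 \<le> t" for c t
  proof -
    let ?D = "\<lambda>M. distr (restrict_space M (space (A \<Otimes>\<^sub>M B) \<times> {0..t})) (A \<Otimes>\<^sub>M B) fst"
    have "?D M = ?D N"
    proof (rule measure_eqI_rectangles)
      show "finite_measure (?D M)"
        by (rule finite_measure_distr_restrict[OF fin _ fst])
          (simp only: M pair_measureI sets.top sets_Icc_Rplus)
      fix a b assume ab: "a \<in> sets A" "b \<in> sets B"
      then have "a \<times> b \<in> sets (A \<Otimes>\<^sub>M B)" by simp
      then show "emeasure (?D M) (a \<times> b) = emeasure (?D N) (a \<times> b)"
        using ab eq t sets_Icc_Rplus by (simp only: emeasure_restrict_fst[OF M] emeasure_restrict_fst[OF N])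
    qed simp_all
    then have "emeasure (?D M) c = emeasure (?D N) c" by simp
    then show ?thesis
      using c sets_Icc_Rplus by (simp only: emeasure_restrict_fst[OF M] emeasure_restrict_fst[OF N])
  qed
  \<comment> \<open>Now the first side is arbitrary and fixed, and the interval is extended to a
    general measurable set of times.\<close>
  fix c r assume c: "c \<in> sets (A \<Otimes>\<^sub>M B)" and r: "r \<in> sets Rplus"
  let ?D = "\<lambda>M. distr (restrict_space M (c \<times> space Rplus)) Rplus snd"
  have "?D M = ?D N"
  proof (rule measure_eqI_Rplus)
    show "finite_measure (?D M)"
      by (rule finite_measure_distr_restrict[OF fin _ snd])
        (simp only: M c pair_measureI sets.top)
    fix t :: real assume t: "0 \<le> t"
    show "emeasure (?D M) {0..t} = emeasure (?D N) {0..t}"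
      using c t sets_Icc_Rplus eq2 by (simp only: emeasure_restrict_snd[OF M] emeasure_restrict_snd[OF N])
  qed simp_all
  then have "emeasure (?D M) r = emeasure (?D N) r" by simp
  then show "emeasure M (c \<times> r) = emeasure N (c \<times> r)"
    using c r by (simp only: emeasure_restrict_snd[OF M] emeasure_restrict_snd[OF N])
qed

section \<open>Histories and the uniqueness theorem\<close>

definition hist_time :: "nat \<Rightarrow> 'e hhist \<Rightarrow> real" where
  "hist_time n hh = (\<Sum>m<n. snd (snd (fst hh m)))"

text \<open>The remaining time s - S_n is a function of the history, so the action prescribed by a
  deterministic policy is one too.\<close>

lemma hist_time_Yh: "hist_time n (Yh n \<omega>) = Sh n \<omega>"
proof -
  have "Sh n \<omega> = (\<Sum>m<n. Th (Suc m) \<omega>)"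
    unfolding Sh_def by (simp only: sum.atMost_shift) (simp add: Th_def)
  then show ?thesis by (simp add: hist_time_def Yh_def Th_def)
qed

lemma measurable_hist_time [measurable]: "hist_time n \<in> borel_measurable (HistH_M ME n)"
  unfolding hist_time_def
proof (rule borel_measurable_sum)
  fix m assume m: "m \<in> {..<n}"
  have "(\<lambda>hh. snd (snd (fst hh m))) \<in> HistH_M ME n \<rightarrow>\<^sub>M Rplus"
    unfolding HistH_M_def using m by measurable
  then show "(\<lambda>hh. snd (snd (fst hh m))) \<in> borel_measurable (HistH_M ME n)"
    by (rule measurable_RplusD)
qed

text \<open>The nesting of the argument is that of the sets
  \<open>(C \<times> B) \<times> {0..t}\<close> on which the transition law is prescribed: past with
  action, then next state, then holding time.\<close>

definition hist_step :: "nat \<Rightarrow> (('e hhist \<times> nat) \<times> 'e option) \<times> real \<Rightarrow> 'e hhist" where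
  "hist_step n z = (case z of (((hh, a), x'), t) \<Rightarrow>
     (\<lambda>m\<in>{..<Suc n}. if m = n then (snd hh, a, t) else fst hh m, x'))"

lemma hist_step_Yh: "hist_step n (((Yh n \<omega>, Ah n \<omega>), Xh (Suc n) \<omega>), Th (Suc n) \<omega>) = Yh (Suc n) \<omega>"
  by (auto simp: hist_step_def Yh_def Ah_def Xh_def Th_def fun_eq_iff restrict_def)

lemma measurable_hist_step:
  "hist_step n \<in> ((HistH_M ME n \<Otimes>\<^sub>M A_M) \<Otimes>\<^sub>M Ehat_M ME) \<Otimes>\<^sub>M Rplus \<rightarrow>\<^sub>M HistH_M ME (Suc n)"
  unfolding hist_step_def HistH_M_def split_beta'
proof (intro measurable_Pair measurable_restrict)
  fix m assume m: "m \<in> {..<Suc n}"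
  show "(\<lambda>z. if m = n then (snd (fst (fst (fst z))), snd (fst (fst z)), snd z)
      else fst (fst (fst (fst z))) m) \<in> (((Pi\<^sub>M {..<n} (\<lambda>m. Step_M ME) \<Otimes>\<^sub>M Ehat_M ME) \<Otimes>\<^sub>M A_M) \<Otimes>\<^sub>M
        Ehat_M ME) \<Otimes>\<^sub>M Rplus \<rightarrow>\<^sub>M Step_M ME"
  proof (cases "m = n")
    case True then show ?thesis by simp measurable
  next
    case False
    with m have "m \<in> {..<n}" by simp
    with False show ?thesis by simp measurable
  qed
qed measurable

text \<open>The law of a history fixes its joint law with the action, a deterministic function of
  it; the kernel then fixes the joint law with the next state and holding time, from which the next
  history is assembled. The laws of all finite histories determine a measure on the infinite
  product.\<close>

lemma smdp_measure_unique:
  assumes P1: "smdp_measure ME T Q d s x P1" and P2: "smdp_measure ME T Q d s x P2"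
    and x: "x \<in> space (Ehat_M ME)"
    and d: "\<And>n. (\<lambda>hh. d n (s - hist_time n hh) hh) \<in> HistH_M ME n \<rightarrow>\<^sub>M A_M"
    and Q: "\<And>t B. 0 \<le> t \<Longrightarrow> B \<in> sets (Ehat_M ME) \<Longrightarrow>
      (\<lambda>z. Qhat T Q t B (fst z) (snd z)) \<in> borel_measurable (Ehat_M ME \<Otimes>\<^sub>M A_M)"
  shows "P1 = P2"
proof -
  let ?Y = "\<lambda>n P. distr P (HistH_M ME n) (Yh n)"
  let ?HA = "\<lambda>n. HistH_M ME n \<Otimes>\<^sub>M A_M"
  let ?YA = "\<lambda>n P. distr P (?HA n) (\<lambda>\<omega>. (Yh n \<omega>, Ah n \<omega>))"
  let ?K = "\<lambda>n. (?HA n \<Otimes>\<^sub>M Ehat_M ME) \<Otimes>\<^sub>M Rplus"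
  let ?k = "\<lambda>n \<omega>. (((Yh n \<omega>, Ah n \<omega>), Xh (Suc n) \<omega>), Th (Suc n) \<omega>)"
  have prob: "prob_space P" if "smdp_measure ME T Q d s x P" for P
    using that by (simp add: smdp_measure_def)
  have sets: "sets P = sets (Omegahat_M ME)" if "smdp_measure ME T Q d s x P" for P
    using that by (simp add: smdp_measure_def)
  note sp = sets_eq_imp_space_eq[OF sets]
  have meas: "f \<in> P \<rightarrow>\<^sub>M N"
    if "smdp_measure ME T Q d s x P" "f \<in> Omegahat_M ME \<rightarrow>\<^sub>M N" for P f and N :: "'x measure"
    using that(2) by (subst measurable_cong_sets[OF sets[OF that(1)] refl])
  have YA: "(\<lambda>\<omega>. (Yh n \<omega>, Ah n \<omega>)) \<in> Omegahat_M ME \<rightarrow>\<^sub>M ?HA n" for n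
    by (intro measurable_Pair measurable_Yh measurable_Ah)
  have k: "?k n \<in> Omegahat_M ME \<rightarrow>\<^sub>M ?K n" for n
    by (intro measurable_Pair measurable_Yh measurable_Ah measurable_Xh measurable_Th_Suc)
  have Ystep: "?YA n P = distr (?Y n P) (?HA n) (\<lambda>hh. (hh, d n (s - hist_time n hh) hh))"
    if P: "smdp_measure ME T Q d s x P" for P n
  proof -
    have *: "(\<lambda>hh. (hh, d n (s - hist_time n hh) hh)) \<in> HistH_M ME n \<rightarrow>\<^sub>M ?HA n"
      by (rule measurable_Pair[OF measurable_ident_sets[OF refl] d])
    have "distr (?Y n P) (?HA n) (\<lambda>hh. (hh, d n (s - hist_time n hh) hh))
        = distr P (?HA n) ((\<lambda>hh. (hh, d n (s - hist_time n hh) hh)) \<circ> Yh n)"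
      by (rule distr_distr[OF * meas[OF P measurable_Yh]])
    also have "\<dots> = ?YA n P"
    proof (rule distr_cong_AE)
      have "AE \<omega> in P. Ah n \<omega> = d n (s - Sh n \<omega>) (Yh n \<omega>)"
        using P by (simp add: smdp_measure_def)
      then show "AE \<omega> in P. ((\<lambda>hh. (hh, d n (s - hist_time n hh) hh)) \<circ> Yh n) \<omega> = (Yh n \<omega>, Ah n \<omega>)"
        by eventually_elim (simp add: hist_time_Yh)
    qed (simp_all add: meas[OF P YA] measurable_comp[OF meas[OF P measurable_Yh] *])
    finally show ?thesis ..
  qed
  \<comment> \<open>The right-hand side depends on P only through the joint law of history and
    action, which is what makes the induction work.\<close>
  have Kval: "emeasure (distr P (?K n) (?k n)) ((C \<times> B) \<times> {0..t})
      = ennreal (\<integral>z. indicator C z * Qhat T Q t B (snd (fst z)) (snd z) \<partial>?YA n P)"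
    if P: "smdp_measure ME T Q d s x P" and C: "C \<in> sets (?HA n)" and B: "B \<in> sets (Ehat_M ME)"
      and t: "0 \<le> t" for P n C B t
  proof -
    interpret prob_space P by (rule prob[OF P])
    let ?C = "(\<lambda>\<omega>. (Yh n \<omega>, Ah n \<omega>)) -` C \<inter> space P"
    have CF: "?C \<in> sets (FiltA ME n)"
      unfolding FiltA_def sp[OF P] using C by (intro in_vimage_algebra)
    have C': "?C \<in> sets P"
      using measurable_sets[OF meas[OF P YA] C] .
    have Qm: "(\<lambda>z. Qhat T Q t B (snd (fst z)) (snd z)) \<in> borel_measurable (?HA n)"
    proof -
      have "(\<lambda>z. (snd (fst z), snd z)) \<in> ?HA n \<rightarrow>\<^sub>M Ehat_M ME \<Otimes>\<^sub>M A_M"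
        unfolding HistH_M_def by measurable
      from measurable_compose[OF this Q[OF t B]] show ?thesis by simp
    qed
    have "?k n -` ((C \<times> B) \<times> {0..t}) \<inter> space P
        = {\<omega>\<in>space P. Th (Suc n) \<omega> \<le> t \<and> Xh (Suc n) \<omega> \<in> B} \<inter> ?C"
      using Th_Suc_nonneg[of _ ME] by (auto simp: sp[OF P])
    then have "emeasure (distr P (?K n) (?k n)) ((C \<times> B) \<times> {0..t})
        = emeasure P ({\<omega>\<in>space P. Th (Suc n) \<omega> \<le> t \<and> Xh (Suc n) \<omega> \<in> B} \<inter> ?C)"
      using B C sets_Icc_Rplus by (subst emeasure_distr[OF meas[OF P k]]) auto
    also have "\<dots> = ennreal (set_lebesgue_integral P ?C (\<lambda>\<omega>. Qhat T Q t B (Xh n \<omega>) (Ah n \<omega>)))"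
      using P t B CF by (simp add: smdp_measure_def emeasure_eq_measure)
    finally have 1: "emeasure (distr P (?K n) (?k n)) ((C \<times> B) \<times> {0..t})
        = ennreal (set_lebesgue_integral P ?C (\<lambda>\<omega>. Qhat T Q t B (Xh n \<omega>) (Ah n \<omega>)))" .
    have 2: "set_lebesgue_integral P ?C (\<lambda>\<omega>. Qhat T Q t B (Xh n \<omega>) (Ah n \<omega>))
        = (\<integral>\<omega>. (\<lambda>z. indicator C z * Qhat T Q t B (snd (fst z)) (snd z)) (Yh n \<omega>, Ah n \<omega>) \<partial>P)"
      unfolding set_lebesgue_integral_def
      by (rule Bochner_Integration.integral_cong) (auto simp: Yh_def indicator_def)
    have 3: "(\<integral>\<omega>. (\<lambda>z. indicator C z * Qhat T Q t B (snd (fst z)) (snd z)) (Yh n \<omega>, Ah n \<omega>) \<partial>P)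
        = (\<integral>z. indicator C z * Qhat T Q t B (snd (fst z)) (snd z) \<partial>?YA n P)"
      by (rule integral_distr[symmetric, OF meas[OF P YA]])
        (intro borel_measurable_times borel_measurable_indicator C Qm)
    show ?thesis
      unfolding 1 2 3 ..
  qed
  have law: "?Y n P1 = ?Y n P2" for n
  proof (induction n)
    case 0
    \<comment> \<open>The step part of a history of length 0 is a restriction to the empty set,
      hence constantly \<open>undefined\<close>; only the initial state remains, and it is almost
      surely x.\<close>
    have "?Y 0 P = return (HistH_M ME 0) (\<lambda>_. undefined, x)"
      if P: "smdp_measure ME T Q d s x P" for P
    proof -
      interpret prob_space P by (rule prob[OF P])
      have c: "(\<lambda>_. undefined, x) \<in> space (HistH_M ME 0)"
        using x by (simp add: HistH_M_def space_pair_measure space_PiM)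
      have "?Y 0 P = distr P (HistH_M ME 0) (\<lambda>_. (\<lambda>_. undefined, x))"
      proof (rule distr_cong_AE)
        have "AE \<omega> in P. Xh 0 \<omega> = x"
          using P by (simp add: smdp_measure_def)
        then show "AE \<omega> in P. Yh 0 \<omega> = (\<lambda>_. undefined, x)"
          by eventually_elim (simp add: Yh_def restrict_def)
      qed (use c meas[OF P measurable_Yh] in simp_all)
      also have "\<dots> = return (HistH_M ME 0) (\<lambda>_. undefined, x)"
        using c by (rule distr_const)
      finally show ?thesis .
    qed
    with P1 P2 show ?case by simp
  next
    case (Suc n)
    have YAeq: "?YA n P1 = ?YA n P2"
      unfolding Ystep[OF P1] Ystep[OF P2] Suc ..
    have "distr P1 (?K n) (?k n) = distr P2 (?K n) (?k n)"
    proof (rule measure_eqI_rectangles_Rplus)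
      interpret prob_space P1 by (rule prob[OF P1])
      show "finite_measure (distr P1 (?K n) (?k n))"
        by (rule finite_measure_distr[OF meas[OF P1 k]])
      fix C B t assume "C \<in> sets (?HA n)" "B \<in> sets (Ehat_M ME)" "0 \<le> (t::real)"
      then show "emeasure (distr P1 (?K n) (?k n)) ((C \<times> B) \<times> {0..t})
          = emeasure (distr P2 (?K n) (?k n)) ((C \<times> B) \<times> {0..t})"
        by (simp only: Kval[OF P1] Kval[OF P2] YAeq)
    qed simp_all
    moreover have "?Y (Suc n) P = distr (distr P (?K n) (?k n)) (HistH_M ME (Suc n)) (hist_step n)"
      if P: "smdp_measure ME T Q d s x P" for P
      using distr_distr[OF measurable_hist_step meas[OF P k]]
      by (simp add: comp_def hist_step_Yh)
    ultimately show ?case using P1 P2 by simp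
  qed
  show ?thesis
  proof (rule measure_eqI_PiM_infinite)
    show "sets P1 = sets (\<Pi>\<^sub>M n\<in>UNIV. Step_M ME)" "sets P2 = sets (\<Pi>\<^sub>M n\<in>UNIV. Step_M ME)"
      using sets[OF P1] sets[OF P2] by (simp_all add: Omegahat_M_def)
    show "finite_measure P1"
      using prob[OF P1] by (simp add: prob_space_def)
    fix A :: "nat \<Rightarrow> ('a option \<times> nat \<times> real) set" and J :: "nat set"
    assume J: "finite J" "J \<subseteq> UNIV" and A: "\<And>i. i \<in> J \<Longrightarrow> A i \<in> sets (Step_M ME)"
    \<comment> \<open>Finitely many coordinates lie below some n, so the cylinder is an event of the
      history of length n whose current state is left free.\<close>
    obtain n where n: "J \<subseteq> {..<n}"
      using J(1) finite_nat_bounded by blast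
    let ?X = "prod_emb {..<n} (\<lambda>_. Step_M ME) J (Pi\<^sub>E J A) \<times> space (Ehat_M ME)"
    have X: "?X \<in> sets (HistH_M ME n)"
      unfolding HistH_M_def using J(1) n A by (intro pair_measureI sets_PiM_I sets.top) auto
    have "emeasure P (prod_emb UNIV (\<lambda>_. Step_M ME) J (Pi\<^sub>E J A)) = emeasure (?Y n P) ?X"
      if P: "smdp_measure ME T Q d s x P" for P
    proof -
      have "prod_emb UNIV (\<lambda>_. Step_M ME) J (Pi\<^sub>E J A) = Yh n -` ?X \<inter> space P"
      proof (intro equalityI subsetI)
        fix \<omega> assume w: "\<omega> \<in> prod_emb UNIV (\<lambda>_. Step_M ME) J (Pi\<^sub>E J A)"
        then have "\<omega> \<in> space P"
          by (auto simp: prod_emb_def sp[OF P] Omegahat_M_def space_PiM)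
        moreover from this have "Yh n \<omega> \<in> space (HistH_M ME n)"
          using measurable_space[OF meas[OF P measurable_Yh]] by blast
        moreover have "restrict (restrict \<omega> {..<n}) J = restrict \<omega> J"
          using n by (auto simp: restrict_def fun_eq_iff)
        ultimately show "\<omega> \<in> Yh n -` ?X \<inter> space P"
          using w by (auto simp: prod_emb_def Yh_def HistH_M_def space_pair_measure space_PiM)
      next
        fix \<omega> assume w: "\<omega> \<in> Yh n -` ?X \<inter> space P"
        moreover have "restrict (restrict \<omega> {..<n}) J = restrict \<omega> J"
          using n by (auto simp: restrict_def fun_eq_iff)
        ultimately show "\<omega> \<in> prod_emb UNIV (\<lambda>_. Step_M ME) J (Pi\<^sub>E J A)"
          by (auto simp: prod_emb_def Yh_def sp[OF P] Omegahat_M_def space_PiM)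
      qed
      then show ?thesis
        by (simp only: emeasure_distr[OF meas[OF P measurable_Yh] X])
    qed
    then show "emeasure P1 (prod_emb UNIV (\<lambda>_. Step_M ME) J (Pi\<^sub>E J A))
        = emeasure P2 (prod_emb UNIV (\<lambda>_. Step_M ME) J (Pi\<^sub>E J A))"
      using P1 P2 law by simp
  qed
qed

section \<open>The induced policy\<close>

lemma kernel_bounds:
  assumes "semi_markov_kernel ME Q" "0 \<le> t" "B \<in> sets ME" "x \<in> space ME"
  shows "0 \<le> Q t B x" "Q t B x \<le> 1"
proof -
  from assms obtain \<mu> where "subprob_space \<mu>" "Q t B x = measure \<mu> B"
    unfolding semi_markov_kernel_def by blast
  then show "0 \<le> Q t B x" "Q t B x \<le> 1"
    by (simp_all add: subprob_space.subprob_measure_le_1)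
qed

lemma kernel_measurable:
  assumes "semi_markov_kernel ME Q" "0 \<le> t" "B \<in> sets ME"
  shows "Q t B \<in> borel_measurable ME"
  using assms unfolding semi_markov_kernel_def by blast

lemma kernel_0:
  assumes "semi_markov_kernel ME Q" "B \<in> sets ME" "x \<in> space ME"
  shows "Q 0 B x = 0"
  using assms unfolding semi_markov_kernel_def by blast

lemma measurable_If_A_M:
  "Measurable.pred M R \<Longrightarrow> (\<lambda>x. if R x then 1 else 0) \<in> M \<rightarrow>\<^sub>M A_M"
  by (rule measurable_If) (simp_all add: pred_def)

lemma pred_not_None: "Measurable.pred (Ehat_M ME) (\<lambda>y. y \<noteq> None)"
  by (rule pred_intros_logic(2)[OF pred_None_Ehat_M])

lemma pred_eq_0_A_M: "Measurable.pred A_M (\<lambda>a. a = 0)"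
  by (auto simp: A_M_def pred_def)

lemma measurable_Qhat:
  assumes Q: "semi_markov_kernel ME Q" and t: "0 \<le> t" and B: "B \<in> sets (Ehat_M ME)"
    and x0: "x0 \<in> space ME"
  shows "(\<lambda>z. Qhat T Q t B (fst z) (snd z)) \<in> borel_measurable (Ehat_M ME \<Otimes>\<^sub>M A_M)"
proof -
  have B': "{y. Some y \<in> B} \<in> sets ME"
    using B by (simp add: sets_Ehat_M_iff)
  \<comment> \<open>Where the first branch is taken, \<open>the_or x0\<close> agrees with
    \<open>the\<close>; elsewhere its value does not enter.\<close>
  have "(\<lambda>z. if fst z \<noteq> None \<and> snd z = 0 then Q t {y. Some y \<in> B} (the_or x0 (fst z))
      else indicator {T + 1..} t * indicator B None) \<in> borel_measurable (Ehat_M ME \<Otimes>\<^sub>M A_M)"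
  proof (rule measurable_If)
    show "{z \<in> space (Ehat_M ME \<Otimes>\<^sub>M A_M). fst z \<noteq> None \<and> snd z = 0} \<in> sets (Ehat_M ME \<Otimes>\<^sub>M A_M)"
      unfolding pred_def[symmetric]
      by (rule pred_intros_logic(3)[OF measurable_compose[OF measurable_fst pred_not_None]
            measurable_compose[OF measurable_snd pred_eq_0_A_M]])
    show "(\<lambda>z. Q t {y. Some y \<in> B} (the_or x0 (fst z))) \<in> borel_measurable (Ehat_M ME \<Otimes>\<^sub>M A_M)"
      by (rule measurable_compose[OF measurable_compose[OF measurable_fst measurable_the_or[OF x0]]
            kernel_measurable[OF Q t B']])
  qed simp
  moreover have "(\<lambda>z. if fst z \<noteq> None \<and> snd z = 0 then Q t {y. Some y \<in> B} (the_or x0 (fst z))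
      else indicator {T + 1..} t * indicator B None) = (\<lambda>z. Qhat T Q t B (fst z) (snd z))"
    by (auto simp: Qhat_def fun_eq_iff the_or_def)
  ultimately show ?thesis by (simp only:)
qed

text \<open>\<open>Btau\<close> is a direct image, so membership only says that some path with the
  same history stops at n. Since the event of stopping at n is a preimage under \<open>Ys n\<close>,
  all paths sharing that history stop at n as well.\<close>

lemma Btau_vimage:
  assumes st: "stopping_time_smp ME \<tau>" and w: "\<omega> \<in> space (Omega_M ME)"
  shows "Ys n \<omega> \<in> Btau ME \<tau> n \<longleftrightarrow> \<tau> \<omega> = enat n"
proof
  assume "Ys n \<omega> \<in> Btau ME \<tau> n"
  then obtain \<omega>' where w': "\<omega>' \<in> space (Omega_M ME)" "\<tau> \<omega>' = enat n" "Ys n \<omega> = Ys n \<omega>'"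
    by (auto simp: Btau_def)
  have "{\<omega> \<in> space (Omega_M ME). \<tau> \<omega> = enat n} \<in> sets (Filt ME n)"
    using st by (simp add: stopping_time_smp_def)
  then obtain B where B: "{\<omega> \<in> space (Omega_M ME). \<tau> \<omega> = enat n} = Ys n -` B \<inter> space (Omega_M ME)"
    unfolding Filt_def
    by (subst (asm) sets_vimage_algebra2) (use measurable_space[OF measurable_Ys] in auto)
  have "\<omega>' \<in> Ys n -` B \<inter> space (Omega_M ME)" using w' B by blast
  then have "\<omega> \<in> Ys n -` B \<inter> space (Omega_M ME)" using w w' by simp
  then show "\<tau> \<omega> = enat n" using B by blast
qed (use w in \<open>auto simp: Btau_def\<close>)

text \<open>Direct images of measurable sets need not be measurable. Here the image is the very set
  B whose preimage is the stopping event, because \<open>Ys n\<close> maps onto the space of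
  histories.\<close>

lemma sets_Btau:
  assumes st: "stopping_time_smp ME \<tau>" and x0: "x0 \<in> space ME"
  shows "Btau ME \<tau> n \<in> sets (Hist_M ME n)"
proof -
  have "{\<omega> \<in> space (Omega_M ME). \<tau> \<omega> = enat n} \<in> sets (Filt ME n)"
    using st by (simp add: stopping_time_smp_def)
  then obtain B where B: "{\<omega> \<in> space (Omega_M ME). \<tau> \<omega> = enat n} = Ys n -` B \<inter> space (Omega_M ME)"
    and Bs: "B \<in> sets (Hist_M ME n)"
    unfolding Filt_def
    by (subst (asm) sets_vimage_algebra2) (use measurable_space[OF measurable_Ys] in auto)
  have "Btau ME \<tau> n = B"
  proof (intro equalityI subsetI)
    fix h assume h: "h \<in> B"
    then have hs: "h \<in> space (Hist_M ME n)"
      using sets.sets_into_space[OF Bs] by (rule subsetD[rotated])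
    \<comment> \<open>Any continuation extends the history to a full path; holding times 0 in the
      state \<open>x0\<close> serve.\<close>
    let ?w = "(fst h, \<lambda>m. if m < n then snd h m else (0, x0))"
    have w: "?w \<in> space (Omega_M ME)"
    proof -
      have "fst h \<in> space ME" "\<And>m. m < n \<Longrightarrow> snd h m \<in> space (Rplus \<Otimes>\<^sub>M ME)"
        using hs by (simp_all add: Hist_M_def space_pair_measure[of ME] space_PiM PiE_iff mem_Times_iff)
      then show ?thesis
        using x0 by (simp add: Omega_M_def space_pair_measure space_PiM PiE_iff)
    qed
    have Y: "Ys n ?w = h"
    proof -
      have "snd h \<in> extensional {..<n}"
        using hs by (simp add: Hist_M_def space_pair_measure[of ME] space_PiM PiE_iff mem_Times_iff)
      then have "restrict (\<lambda>m. if m < n then snd h m else (0, x0)) {..<n} = snd h"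
        by (auto simp: restrict_def extensional_def fun_eq_iff)
      then show ?thesis by (simp add: Ys_def)
    qed
    have "?w \<in> Ys n -` B \<inter> space (Omega_M ME)"
      using w Y h by simp
    then have "?w \<in> {\<omega> \<in> space (Omega_M ME). \<tau> \<omega> = enat n}"
      using B by blast
    then show "h \<in> Btau ME \<tau> n"
      unfolding Btau_def by (intro image_eqI[where x = ?w]) (simp_all only: Y)
  qed (use B in \<open>auto simp: Btau_def\<close>)
  then show ?thesis using Bs by simp
qed

text \<open>The counterpart of \<open>h0_to_hist\<close> with \<open>the_or\<close> in place of
  \<open>the\<close>: measurable on all histories and unchanged on \<open>H0\<close>.\<close>

definition h0_to_hist_or :: "'e \<Rightarrow> nat \<Rightarrow> 'e hhist \<Rightarrow> 'e \<times> (nat \<Rightarrow> real \<times> 'e)" where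
  "h0_to_hist_or x0 n hh = (the_or x0 (if 0 < n then fst (fst hh 0) else snd hh),
     \<lambda>m\<in>{..<n}. (snd (snd (fst hh m)), the_or x0 (if Suc m < n then fst (fst hh (Suc m)) else snd hh)))"

lemma h0_to_hist_or_eq:
  "hh \<in> H0 ME n \<Longrightarrow> h0_to_hist_or x0 n hh = h0_to_hist n hh"
  by (auto simp: H0_def h0_to_hist_or_def h0_to_hist_def fun_eq_iff restrict_def Let_def the_or_def
      split: option.splits)

lemma measurable_hist_state: 
  assumes "m < n" shows "(\<lambda>hh. fst hh m) \<in> HistH_M ME n \<rightarrow>\<^sub>M Step_M ME"
  unfolding HistH_M_def
  by (rule measurable_compose[OF measurable_fst measurable_component_singleton]) (use assms in simp)

lemma measurable_hist_last: "snd \<in> HistH_M ME n \<rightarrow>\<^sub>M Ehat_M ME"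
  unfolding HistH_M_def by (rule measurable_snd)

lemma measurable_h0_to_hist_or:
  assumes x0: "x0 \<in> space ME"
  shows "h0_to_hist_or x0 n \<in> HistH_M ME n \<rightarrow>\<^sub>M Hist_M ME n"
proof -
  note 1 = measurable_compose[OF measurable_hist_state measurable_fst]
  have 2: "(\<lambda>hh. the_or x0 (if m < n then fst (fst hh m) else snd hh)) \<in> HistH_M ME n \<rightarrow>\<^sub>M ME" for m
    by (cases "m < n")
      (simp_all add: measurable_compose[OF 1 measurable_the_or[OF x0]]
        measurable_compose[OF measurable_hist_last measurable_the_or[OF x0]])
  show ?thesis
    unfolding h0_to_hist_or_def Hist_M_def
    by (intro measurable_Pair measurable_restrict 2
        measurable_compose[OF measurable_compose[OF measurable_hist_state measurable_snd] measurable_snd])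
      simp
qed

text \<open>On the space of histories, membership in \<open>H0\<close> reduces to finitely many
  measurable conditions: no state is \<open>None\<close> and all recorded actions are 0. The policy
  is then the indicator of the implication from these conditions to the stopping condition.\<close>

lemma measurable_d_tau:
  assumes st: "stopping_time_smp ME \<tau>" and x0: "x0 \<in> space ME"
  shows "(\<lambda>hh. d_tau ME \<tau> n (s - hist_time n hh) hh) \<in> HistH_M ME n \<rightarrow>\<^sub>M A_M"
proof -
  let ?H = "\<lambda>hh. (\<forall>m\<in>{..<n}. fst (fst hh m) \<noteq> None \<and> fst (snd (fst hh m)) = (0::nat)) \<and> snd hh \<noteq> None"
  let ?B = "\<lambda>hh. h0_to_hist_or x0 n hh \<in> Btau ME \<tau> n \<and> 0 < s - hist_time n hh"
  have H: "hh \<in> H0 ME n \<longleftrightarrow> ?H hh" if "hh \<in> space (HistH_M ME n)" for hh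
  proof -
    have "fst hh \<in> extensional {..<n}"
      using that by (simp add: HistH_M_def space_pair_measure space_PiM PiE_iff mem_Times_iff)
    moreover have 1: "fst hh m \<in> space (Step_M ME)" if "m < n" for m
      using \<open>hh \<in> space (HistH_M ME n)\<close> that
      by (simp add: HistH_M_def space_pair_measure space_PiM PiE_iff mem_Times_iff)
    moreover have "fst (fst hh m) \<in> Some ` space ME \<longleftrightarrow> fst (fst hh m) \<noteq> None"
      "0 \<le> snd (snd (fst hh m))" if "m < n" for m
      using 1[OF that] by (auto simp: space_pair_measure mem_Times_iff)
    moreover have "snd hh \<in> Some ` space ME \<longleftrightarrow> snd hh \<noteq> None"
      using \<open>hh \<in> space (HistH_M ME n)\<close> by (auto simp: HistH_M_def space_pair_measure mem_Times_iff)
    ultimately show ?thesis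
      unfolding H0_def case_prod_beta mem_Collect_eq Ball_def lessThan_iff by (simp del: not_None_eq)
  qed
  have "Measurable.pred (HistH_M ME n) ?H"
  proof (intro pred_intros_logic(2,3) pred_intros_finite(3) finite_lessThan)
    fix m assume m: "m \<in> {..<n}"
    show "Measurable.pred (HistH_M ME n) (\<lambda>hh. fst (fst hh m) = None)"
      by (rule measurable_compose[OF measurable_compose[OF measurable_hist_state[OF lessThan_iff[THEN iffD1, OF m]] measurable_fst] pred_None_Ehat_M])
    show "Measurable.pred (HistH_M ME n) (\<lambda>hh. fst (snd (fst hh m)) = 0)"
      by (rule measurable_compose[OF measurable_compose[OF measurable_compose[OF measurable_hist_state[OF lessThan_iff[THEN iffD1, OF m]] measurable_snd] measurable_fst] pred_eq_0_A_M])
  next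
    show "Measurable.pred (HistH_M ME n) (\<lambda>hh. snd hh = None)"
      by (rule measurable_compose[OF measurable_hist_last pred_None_Ehat_M])
  qed
  moreover have "Measurable.pred (HistH_M ME n) ?B"
  proof (rule pred_intros_logic(3))
    show "Measurable.pred (HistH_M ME n) (\<lambda>hh. h0_to_hist_or x0 n hh \<in> Btau ME \<tau> n)"
      by (rule pred_sets2[OF sets_Btau[OF st x0] measurable_h0_to_hist_or[OF x0]])
    show "Measurable.pred (HistH_M ME n) (\<lambda>hh. 0 < s - hist_time n hh)"
      using measurable_hist_time by measurable
  qed
  ultimately have "Measurable.pred (HistH_M ME n) (\<lambda>hh. ?H hh \<longrightarrow> ?B hh)"
    by (rule pred_intros_logic(4))
  then have "(\<lambda>hh. if ?H hh \<longrightarrow> ?B hh then 1 else 0) \<in> HistH_M ME n \<rightarrow>\<^sub>M A_M"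
    by (rule measurable_If_A_M)
  then show ?thesis
  proof (rule measurable_cong[THEN iffD1, rotated])
    fix hh assume hh: "hh \<in> space (HistH_M ME n)"
    show "(if ?H hh \<longrightarrow> ?B hh then 1 else 0) = d_tau ME \<tau> n (s - hist_time n hh) hh"
      unfolding H[OF hh, symmetric] using h0_to_hist_or_eq[of hh ME n x0] by (simp add: d_tau_def)
  qed
qed

section \<open>The law of the stopped path\<close>

text \<open>The strict inequality agrees both with the reward, which pays g only if S_tau < s, and
  with the policy, which demands positive remaining time. At most one k qualifies on a given
  path.\<close>

definition stopped_at :: "('e omega \<Rightarrow> enat) \<Rightarrow> real \<Rightarrow> nat \<Rightarrow> 'e omega \<Rightarrow> bool" where
  "stopped_at \<tau> s k \<omega> \<longleftrightarrow> \<tau> \<omega> = enat k \<and> Ss k \<omega> < s"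

text \<open>The bounds differ on purpose. At the stopping index the state is still the original one,
  so that \<open>ghat\<close> can read it together with action 1, while action and holding time have
  already changed there. The value \<open>T + 1\<close> is the atom of \<open>Qhat\<close> under
  action 1.\<close>

definition stop_path :: "real \<Rightarrow> ('e omega \<Rightarrow> enat) \<Rightarrow> real \<Rightarrow> 'e omega \<Rightarrow> 'e homega" where
  "stop_path T \<tau> s \<omega> m =
     (if \<exists>k<m. stopped_at \<tau> s k \<omega> then None else Some (Xs m \<omega>),
      if \<exists>k\<le>m. stopped_at \<tau> s k \<omega> then 1 else 0,
      if \<exists>k\<le>m. stopped_at \<tau> s k \<omega> then T + 1 else Ts (Suc m) \<omega>)"

lemma pred_stopped_Filt:
  assumes "stopping_time_smp ME \<tau>" "k \<le> n"
  shows "Measurable.pred (Filt ME n) (stopped_at \<tau> s k)"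
proof -
  have "Measurable.pred (Filt ME n) (\<lambda>\<omega>. \<tau> \<omega> = enat k)"
    using stopping_sets[OF assms] by (simp add: pred_def)
  moreover have "Measurable.pred (Filt ME n) (\<lambda>\<omega>. Ss k \<omega> < s)"
    by (rule borel_measurable_pred_less[OF measurable_Ss_Filt[OF assms(2)] borel_measurable_const])
  ultimately show ?thesis
    unfolding stopped_at_def by (rule pred_intros_logic(3))
qed

lemma pred_ex_stopped_Filt:
  assumes "stopping_time_smp ME \<tau>" "finite K" "K \<subseteq> {..n}"
  shows "Measurable.pred (Filt ME n) (\<lambda>\<omega>. \<exists>k\<in>K. stopped_at \<tau> s k \<omega>)"
  by (rule pred_intros_finite(4)[OF assms(2) pred_stopped_Filt[OF assms(1)]]) (use assms(3) in auto)

lemma Xh_stop_path: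
  "Xh m (stop_path T \<tau> s \<omega>) = (if \<exists>k\<in>{..<m}. stopped_at \<tau> s k \<omega> then None else Some (Xs m \<omega>))"
  and Ah_stop_path:
  "Ah m (stop_path T \<tau> s \<omega>) = (if \<exists>k\<in>{..m}. stopped_at \<tau> s k \<omega> then 1 else 0)"
  and Th_stop_path:
  "Th (Suc m) (stop_path T \<tau> s \<omega>) = (if \<exists>k\<in>{..m}. stopped_at \<tau> s k \<omega> then T + 1 else Ts (Suc m) \<omega>)"
  by (auto simp: Xh_def Ah_def Th_def stop_path_def)

lemma stop_path_eq:
  "stop_path T \<tau> s \<omega> m = (Xh m (stop_path T \<tau> s \<omega>), Ah m (stop_path T \<tau> s \<omega>), Th (Suc m) (stop_path T \<tau> s \<omega>))"
  by (simp add: Xh_def Ah_def Th_def)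

text \<open>S_n contains holding times of steps before n only, so a stop at n itself leaves it
  unchanged; hence the strict bound on k.\<close>

lemma Sh_stop_path:
  assumes "\<And>k. k < n \<Longrightarrow> \<not> stopped_at \<tau> s k \<omega>"
  shows "Sh n (stop_path T \<tau> s \<omega>) = Ss n \<omega>"
  unfolding Sh_def Ss_def
proof (rule sum.cong[OF refl])
  fix k assume k: "k \<in> {..n}"
  show "Th k (stop_path T \<tau> s \<omega>) = Ts k \<omega>"
  proof (cases k)
    case 0 then show ?thesis by (simp add: Th_def Ts_def)
  next
    case (Suc m)
    then have "\<not> (\<exists>k\<in>{..m}. stopped_at \<tau> s k \<omega>)" using assms k by auto
    then show ?thesis by (simp only: Suc Th_stop_path if_False)
  qed
qed

lemma Yh_stop_path:
  assumes "\<And>k. k < n \<Longrightarrow> \<not> stopped_at \<tau> s k \<omega>"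
  shows "Yh n (stop_path T \<tau> s \<omega>) = Y0 n \<omega>"
proof -
  have "restrict (stop_path T \<tau> s \<omega>) {..<n} = (\<lambda>m\<in>{..<n}. (Some (Xs m \<omega>), 0, Ts (Suc m) \<omega>))"
  proof (rule restrict_ext)
    fix m assume "m \<in> {..<n}"
    then have "\<not> (\<exists>k<m. stopped_at \<tau> s k \<omega>)" "\<not> (\<exists>k\<le>m. stopped_at \<tau> s k \<omega>)"
      using assms by auto
    then show "stop_path T \<tau> s \<omega> m = (Some (Xs m \<omega>), 0, Ts (Suc m) \<omega>)"
      by (simp only: stop_path_def if_False)
  qed
  moreover have "\<not> (\<exists>k\<in>{..<n}. stopped_at \<tau> s k \<omega>)" using assms by auto
  ultimately show ?thesis
    by (simp only: Yh_def Y0_def Xh_stop_path if_False)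
qed

lemma Y0_H0: "\<omega> \<in> space (Omega_M ME) \<Longrightarrow> Y0 n \<omega> \<in> H0 ME n"
  using measurable_space[OF measurable_Xs, of \<omega> ME] Ts_Suc_nonneg[of \<omega> ME]
  by (simp add: Y0_def H0_def)

lemma h0_to_hist_Y0: "h0_to_hist n (Y0 n \<omega>) = Ys n \<omega>"
  by (auto simp: h0_to_hist_def Y0_def Ys_def Let_def Xs_def Ts_def restrict_def fun_eq_iff prod_eq_iff
      less_Suc_eq split: nat.splits)

text \<open>Histories with only zero actions lie in \<open>H0\<close>, and there
  \<open>Btau_vimage\<close> turns the set test of the policy into the event of stopping at
  n.\<close>

lemma d_tau_Y0:
  assumes st: "stopping_time_smp ME \<tau>" and w: "\<omega> \<in> space (Omega_M ME)"
  shows "d_tau ME \<tau> n (s - Ss n \<omega>) (Y0 n \<omega>) = (if stopped_at \<tau> s n \<omega> then 1 else 0)"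
  using w by (simp add: d_tau_def Y0_H0 h0_to_hist_Y0 Btau_vimage[OF st] stopped_at_def)

lemma smp_measure_step:
  assumes "smp_measure ME Q x P" "0 \<le> t" "B \<in> sets ME" "C \<in> sets (Filt ME n)"
  shows "measure P ({\<omega>\<in>space P. Ts (Suc n) \<omega> \<le> t \<and> Xs (Suc n) \<omega> \<in> B} \<inter> C) = (LINT \<omega>:C|P. Q t B (Xs n \<omega>))"
  using assms unfolding smp_measure_def by blast

context
  fixes ME :: "'e measure" and \<tau> :: "'e omega \<Rightarrow> enat" and T :: real
  assumes st: "stopping_time_smp ME \<tau>" and T: "0 \<le> T"
begin

lemma measurable_Xh_stop_path:
  assumes "m \<le> n" shows "(\<lambda>\<omega>. Xh m (stop_path T \<tau> s \<omega>)) \<in> Filt ME n \<rightarrow>\<^sub>M Ehat_M ME"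
  unfolding Xh_stop_path
proof (rule measurable_If)
  show "{\<omega> \<in> space (Filt ME n). \<exists>k\<in>{..<m}. stopped_at \<tau> s k \<omega>} \<in> sets (Filt ME n)"
    unfolding pred_def[symmetric] using assms by (intro pred_ex_stopped_Filt st) auto
  show "(\<lambda>\<omega>. Some (Xs m \<omega>)) \<in> Filt ME n \<rightarrow>\<^sub>M Ehat_M ME"
    by (rule measurable_compose[OF measurable_Xs_Filt[OF assms] measurable_Some])
qed simp

lemma measurable_Ah_stop_path:
  assumes "m \<le> n" shows "(\<lambda>\<omega>. Ah m (stop_path T \<tau> s \<omega>)) \<in> Filt ME n \<rightarrow>\<^sub>M A_M"
  unfolding Ah_stop_path
  using assms by (intro measurable_If_A_M pred_ex_stopped_Filt st) auto

lemma measurable_Th_stop_path: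
  assumes "m < n" shows "(\<lambda>\<omega>. Th (Suc m) (stop_path T \<tau> s \<omega>)) \<in> Filt ME n \<rightarrow>\<^sub>M Rplus"
  unfolding Th_stop_path
proof (rule measurable_If)
  show "{\<omega> \<in> space (Filt ME n). \<exists>k\<in>{..m}. stopped_at \<tau> s k \<omega>} \<in> sets (Filt ME n)"
    unfolding pred_def[symmetric] using assms by (intro pred_ex_stopped_Filt st) auto
  show "Ts (Suc m) \<in> Filt ME n \<rightarrow>\<^sub>M Rplus"
    using assms by (intro measurable_Ts_Filt) simp
qed (use T in simp)

lemma measurable_stop_path_Filt:
  assumes "m < n" shows "(\<lambda>\<omega>. stop_path T \<tau> s \<omega> m) \<in> Filt ME n \<rightarrow>\<^sub>M Step_M ME"
  unfolding stop_path_eq[where m = m] using assms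
  by (intro measurable_Pair measurable_Xh_stop_path measurable_Ah_stop_path measurable_Th_stop_path) simp_all

lemma measurable_stop_path: "stop_path T \<tau> s \<in> Omega_M ME \<rightarrow>\<^sub>M Omegahat_M ME"
  unfolding Omegahat_M_def
proof (rule measurable_PiM_single')
  show "(\<lambda>\<omega>. stop_path T \<tau> s \<omega> m) \<in> Omega_M ME \<rightarrow>\<^sub>M Step_M ME" for m
    by (rule measurable_Filt_OmegaD[OF measurable_stop_path_Filt[OF lessI]])
  show "stop_path T \<tau> s \<in> space (Omega_M ME) \<rightarrow> (\<Pi>\<^sub>E m\<in>UNIV. space (Step_M ME))"
    unfolding PiE_UNIV_domain
    by (intro Pi_I measurable_space[OF measurable_Filt_OmegaD[OF measurable_stop_path_Filt[OF lessI]]])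
qed

text \<open>Adaptedness of the stopped path: events of the decision process up to step n pull back
  to events of \<open>Filt ME n\<close>, the only ones to which the defining property of
  \<open>P\<close> applies.\<close>

lemma measurable_YA_stop_path:
  "(\<lambda>\<omega>. (Yh n (stop_path T \<tau> s \<omega>), Ah n (stop_path T \<tau> s \<omega>))) \<in> Filt ME n \<rightarrow>\<^sub>M HistH_M ME n \<Otimes>\<^sub>M A_M"
  unfolding Yh_def HistH_M_def
proof (intro measurable_Pair measurable_Xh_stop_path measurable_Ah_stop_path order_refl)
  show "(\<lambda>\<omega>. restrict (stop_path T \<tau> s \<omega>) {..<n}) \<in> Filt ME n \<rightarrow>\<^sub>M Pi\<^sub>M {..<n} (\<lambda>m. Step_M ME)"
    by (rule measurable_restrict) (rule measurable_stop_path_Filt, simp)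
qed

text \<open>After an earlier stop the history records an action 1, lies outside \<open>H0\<close>,
  and the policy answers 1. Otherwise the clock and the history are those of the original path and
  the policy decides as in \<open>d_tau_Y0\<close>.\<close>

lemma policy_stop_path:
  assumes w: "\<omega> \<in> space (Omega_M ME)"
  shows "Ah n (stop_path T \<tau> s \<omega>)
    = d_tau ME \<tau> n (s - Sh n (stop_path T \<tau> s \<omega>)) (Yh n (stop_path T \<tau> s \<omega>))"
proof (cases "\<exists>k<n. stopped_at \<tau> s k \<omega>")
  case True
  then obtain k where k: "k < n" "stopped_at \<tau> s k \<omega>" by blast
  have "Ah k (stop_path T \<tau> s \<omega>) = 1" "Ah n (stop_path T \<tau> s \<omega>) = 1"
    unfolding Ah_stop_path using k by auto
  moreover from this have "Yh n (stop_path T \<tau> s \<omega>) \<notin> H0 ME n"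
    using k by (auto simp: H0_def Yh_def Ah_def)
  ultimately show ?thesis
    by (simp add: d_tau_def)
next
  case False
  then have "Ah n (stop_path T \<tau> s \<omega>) = (if stopped_at \<tau> s n \<omega> then 1 else 0)"
    unfolding Ah_stop_path by (auto simp: le_less)
  then show ?thesis
    using False by (simp add: Sh_stop_path Yh_stop_path d_tau_Y0[OF st w])
qed

text \<open>The transition law is checked separately according to whether a stop has occurred by
  step n. Without a stop it is the law of the original process; after one the next state and holding
  time are deterministic.\<close>

lemma smdp_measure_stop_path:
  assumes P: "smp_measure ME Q x P" and Q: "semi_markov_kernel ME Q"
    and x: "x \<in> space ME" "{x} \<in> sets ME"
  shows "smdp_measure ME T Q (d_tau ME \<tau>) s (Some x) (distr P (Omegahat_M ME) (stop_path T \<tau> s))"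
  unfolding smdp_measure_def
proof (intro conjI allI ballI impI)
  let ?\<Phi> = "stop_path T \<tau> s"
  let ?D = "distr P (Omegahat_M ME) ?\<Phi>"
  have sets: "sets P = sets (Omega_M ME)" and "prob_space P"
    using P by (simp_all add: smp_measure_def)
  interpret prob_space P by fact
  have sp: "space P = space (Omega_M ME)"
    by (rule sets_eq_imp_space_eq[OF sets])
  have \<Phi>: "?\<Phi> \<in> P \<rightarrow>\<^sub>M Omegahat_M ME"
    by (subst measurable_cong_sets[OF sets refl]) (rule measurable_stop_path)
  show "prob_space ?D" by (rule prob_space_distr[OF \<Phi>])
  show "sets ?D = sets (Omegahat_M ME)" by simp
  \<comment> \<open>Transferring an almost sure statement through a pushforward requires a
    measurable set, which is where measurability of \<open>{x}\<close> enters.\<close>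
  have "{Some x} \<in> sets (Ehat_M ME)"
    using x by (simp add: sets_Ehat_M_iff)
  from measurable_sets[OF measurable_Xh this]
  have "{\<omega> \<in> space (Omegahat_M ME). Xh 0 \<omega> = Some x} \<in> sets (Omegahat_M ME)"
    by (simp add: vimage_def Int_def conj_commute)
  moreover have "AE \<omega> in P. Xh 0 (?\<Phi> \<omega>) = Some x"
    using P by (simp add: smp_measure_def Xh_stop_path)
  ultimately show "AE \<omega> in ?D. Xh 0 \<omega> = Some x"
    using \<Phi> by (simp add: AE_distr_iff)
  show "AE \<omega> in ?D. Ah n \<omega> = d_tau ME \<tau> n (s - Sh n \<omega>) (Yh n \<omega>)" for n
  proof -
    have d: "(\<lambda>\<omega>. d_tau ME \<tau> n (s - Sh n \<omega>) (Yh n \<omega>)) \<in> Omegahat_M ME \<rightarrow>\<^sub>M count_space UNIV"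
      using measurable_A_MD[OF measurable_compose[OF measurable_Yh measurable_d_tau[OF st x(1)]]]
      by (simp add: hist_time_Yh)
    have a: "Ah n \<in> Omegahat_M ME \<rightarrow>\<^sub>M count_space UNIV"
      by (rule measurable_A_MD[OF measurable_Ah])
    \<comment> \<open>Equality of two maps into the naturals, written as a countable union over
      their common value.\<close>
    have "Measurable.pred (Omegahat_M ME) (\<lambda>\<omega>. \<exists>k. Ah n \<omega> \<in> {k} \<and> d_tau ME \<tau> n (s - Sh n \<omega>) (Yh n \<omega>) \<in> {k})"
      by (intro pred_intros_countable(2) pred_intros_logic(3) pred_sets2[OF _ a] pred_sets2[OF _ d]) simp_all
    then have "{\<omega> \<in> space (Omegahat_M ME). Ah n \<omega> = d_tau ME \<tau> n (s - Sh n \<omega>) (Yh n \<omega>)} \<in> sets (Omegahat_M ME)"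
      by (simp add: pred_def eq_commute)
    from AE_distr_iff[OF \<Phi> this] show ?thesis
      by (rule iffD2) (intro AE_I2 policy_stop_path, simp add: sp)
  qed
  fix n t B C assume t: "0 \<le> (t::real)" and B: "B \<in> sets (Ehat_M ME)" and C: "C \<in> sets (FiltA ME n)"
  let ?Y = "\<lambda>\<omega>. (Yh n \<omega>, Ah n \<omega>)"
  have YA: "?Y \<in> Omegahat_M ME \<rightarrow>\<^sub>M HistH_M ME n \<Otimes>\<^sub>M A_M"
    by (intro measurable_Pair measurable_Yh measurable_Ah)
  obtain C0 where C0: "C0 \<in> sets (HistH_M ME n \<Otimes>\<^sub>M A_M)" "C = ?Y -` C0 \<inter> space (Omegahat_M ME)"
    using C measurable_space[OF YA] unfolding FiltA_def
    by (subst (asm) sets_vimage_algebra2) auto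
  have Cs: "C \<in> sets (Omegahat_M ME)"
    unfolding C0(2) by (rule measurable_sets[OF YA C0(1)])
  let ?C = "?\<Phi> -` C \<inter> space P"
  let ?E = "{\<omega> \<in> space P. \<exists>k\<in>{..n}. stopped_at \<tau> s k \<omega>}"
  have CF: "?C \<in> sets (Filt ME n)"
  proof -
    have "?C = (\<lambda>\<omega>. ?Y (?\<Phi> \<omega>)) -` C0 \<inter> space (Filt ME n)"
      using measurable_space[OF measurable_stop_path] by (auto simp: C0(2) sp)
    then show ?thesis using measurable_sets[OF measurable_YA_stop_path C0(1)] by simp
  qed
  have EF: "?E \<in> sets (Filt ME n)"
    using pred_ex_stopped_Filt[OF st, of "{..n}" n s] by (simp add: pred_def sp)
  have subF: "sets (Filt ME n) \<subseteq> sets P"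
    using sets_Filt_subset sets by simp
  have CE: "?C - ?E \<in> sets (Filt ME n)" "?C \<inter> ?E \<in> sets (Filt ME n)"
    using CF EF by auto
  have CEP: "?C - ?E \<in> sets P" "?C \<inter> ?E \<in> sets P"
    using CE subF by auto
  have B': "{y. Some y \<in> B} \<in> sets ME"
    using B by (simp add: sets_Ehat_M_iff)
  let ?q = "\<lambda>\<omega>. Qhat T Q t B (Xh n \<omega>) (Ah n \<omega>)"
  have q: "?q \<in> borel_measurable (Omegahat_M ME)"
    using measurable_compose[OF measurable_Pair[OF measurable_Xh measurable_Ah] measurable_Qhat[OF Q t B x(1)]]
    by simp
  have qb: "norm (?q \<omega>) \<le> 1" if "\<omega> \<in> space (Omegahat_M ME)" for \<omega>
  proof -
    have "Xh n \<omega> \<in> insert None (Some ` space ME)"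
      using measurable_space[OF measurable_Xh that] by simp
    then show ?thesis
      using kernel_bounds[OF Q t B'] by (auto simp: Qhat_def indicator_def)
  qed
  have qi: "integrable P (\<lambda>\<omega>. ?q (?\<Phi> \<omega>))"
  proof (rule integrable_const_bound[where B = 1])
    show "AE \<omega> in P. norm (?q (?\<Phi> \<omega>)) \<le> 1"
      using qb measurable_space[OF \<Phi>] by (intro AE_I2) blast
    show "(\<lambda>\<omega>. ?q (?\<Phi> \<omega>)) \<in> borel_measurable P"
      by (rule measurable_compose[OF \<Phi> q])
  qed
  let ?A = "{\<omega>\<in>space ?D. Th (Suc n) \<omega> \<le> t \<and> Xh (Suc n) \<omega> \<in> B} \<inter> C"
  have TX: "{\<omega> \<in> space (Omegahat_M ME). Th (Suc n) \<omega> \<le> t \<and> Xh (Suc n) \<omega> \<in> B} \<in> sets (Omegahat_M ME)"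
  proof -
    have "Measurable.pred (Omegahat_M ME) (\<lambda>\<omega>. Th (Suc n) \<omega> \<in> {..t} \<and> Xh (Suc n) \<omega> \<in> B)"
      by (intro pred_intros_logic(3) pred_sets2[OF B measurable_Xh] pred_sets2[OF _ measurable_Th]) simp
    then show ?thesis by (simp add: pred_def)
  qed
  have As: "?A \<in> sets (Omegahat_M ME)"
    using TX Cs by auto
  \<comment> \<open>No stop by step n: the action is 0, the next state is the original one, and the
    kernel property of \<open>P\<close> applies because the conditioning event lies in
    \<open>Filt ME n\<close>.\<close>
  have run: "measure P (?\<Phi> -` ?A \<inter> space P - ?E) = (LINT \<omega>:?C - ?E|P. ?q (?\<Phi> \<omega>))"
  proof -
    have ns: "Th (Suc n) (?\<Phi> \<omega>) = Ts (Suc n) \<omega>" "Xh (Suc n) (?\<Phi> \<omega>) = Some (Xs (Suc n) \<omega>)"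
      "Xh n (?\<Phi> \<omega>) = Some (Xs n \<omega>)" "Ah n (?\<Phi> \<omega>) = 0"
      if "\<omega> \<in> space P - ?E" for \<omega>
      using that unfolding Xh_stop_path Ah_stop_path Th_stop_path by auto
    have "?\<Phi> -` ?A \<inter> space P - ?E
        = {\<omega>\<in>space P. Ts (Suc n) \<omega> \<le> t \<and> Xs (Suc n) \<omega> \<in> {y. Some y \<in> B}} \<inter> (?C - ?E)"
      using ns measurable_space[OF \<Phi>] by auto
    then have "measure P (?\<Phi> -` ?A \<inter> space P - ?E)
        = (LINT \<omega>:?C - ?E|P. Q t {y. Some y \<in> B} (Xs n \<omega>))"
      by (simp only: smp_measure_step[OF P t B' CE(1)])
    also have "\<dots> = (LINT \<omega>:?C - ?E|P. ?q (?\<Phi> \<omega>))"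
      by (rule set_lebesgue_integral_cong[OF CEP(1)]) (auto simp: ns Qhat_def)
    finally show ?thesis .
  qed
  \<comment> \<open>A stop by step n: both sides reduce to the probability of the conditioning event
    times a constant equal to 0 or 1.\<close>
  have stop: "measure P (?\<Phi> -` ?A \<inter> space P \<inter> ?E) = (LINT \<omega>:?C \<inter> ?E|P. ?q (?\<Phi> \<omega>))"
  proof -
    have s: "Th (Suc n) (?\<Phi> \<omega>) = T + 1" "Xh (Suc n) (?\<Phi> \<omega>) = None" "Ah n (?\<Phi> \<omega>) = 1"
      if "\<omega> \<in> ?E" for \<omega>
      using that unfolding Xh_stop_path Ah_stop_path Th_stop_path by (auto simp: less_Suc_eq_le)
    have "(LINT \<omega>:?C \<inter> ?E|P. ?q (?\<Phi> \<omega>))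
        = (LINT \<omega>:?C \<inter> ?E|P. indicator {T + 1..} t * indicator B None)"
      by (rule set_lebesgue_integral_cong[OF CEP(2)]) (auto simp: s Qhat_def)
    also have "\<dots> = measure P (?C \<inter> ?E) * (indicator {T + 1..} t * indicator B None)"
      using CEP(2) by (simp add: set_lebesgue_integral_def)
    also have "\<dots> = measure P (?\<Phi> -` ?A \<inter> space P \<inter> ?E)"
    \<comment> \<open>The next step is deterministic, so the transition event either holds
      throughout or is impossible.\<close>
    proof (cases "T + 1 \<le> t \<and> None \<in> B")
      case True
      have "?\<Phi> -` ?A \<inter> space P \<inter> ?E = ?C \<inter> ?E"
      proof (intro equalityI subsetI)
        fix \<omega> assume w: "\<omega> \<in> ?C \<inter> ?E"
        then have "\<omega> \<in> ?E" by blast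
        then show "\<omega> \<in> ?\<Phi> -` ?A \<inter> space P \<inter> ?E"
          using w True measurable_space[OF \<Phi>, of \<omega>] s[OF \<open>\<omega> \<in> ?E\<close>] by simp
      qed auto
      then show ?thesis using True by simp
    next
      case False
      have "\<omega> \<notin> ?\<Phi> -` ?A" if "\<omega> \<in> ?E" for \<omega>
        using False s[OF that] by auto
      then have "?\<Phi> -` ?A \<inter> space P \<inter> ?E = {}"
        by blast
      then show ?thesis using False by (auto simp: indicator_def)
    qed
    finally show ?thesis ..
  qed
  have "measure ?D ?A = measure P (?\<Phi> -` ?A \<inter> space P)"
    by (rule measure_distr[OF \<Phi>]) (use As in simp)
  also have "\<dots> = measure P (?\<Phi> -` ?A \<inter> space P - ?E) + measure P (?\<Phi> -` ?A \<inter> space P \<inter> ?E)"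
  proof -
    have "?\<Phi> -` ?A \<inter> space P \<in> sets P" "?E \<in> sets P"
      using measurable_sets[OF \<Phi> As] EF subF by auto
    then show ?thesis
      by (subst finite_measure_Union[symmetric]) (auto intro!: arg_cong[where f = "measure P"])
  qed
  also have "\<dots> = (LINT \<omega>:(?C - ?E) \<union> (?C \<inter> ?E)|P. ?q (?\<Phi> \<omega>))"
    unfolding run stop
    using integrable_mult_indicator[OF CEP(1) qi] integrable_mult_indicator[OF CEP(2) qi]
    by (subst set_integral_Un) (auto simp: set_integrable_def)
  also have "(?C - ?E) \<union> (?C \<inter> ?E) = ?C" by blast
  also have "(LINT \<omega>:?C|P. ?q (?\<Phi> \<omega>)) = (LINT \<omega>:C|?D. ?q \<omega>)"
  proof -
    have "(LINT \<omega>:C|?D. ?q \<omega>) = (\<integral>\<omega>. indicator C (?\<Phi> \<omega>) *\<^sub>R ?q (?\<Phi> \<omega>) \<partial>P)"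
      unfolding set_lebesgue_integral_def
      by (rule integral_distr[OF \<Phi>]) (intro borel_measurable_scaleR borel_measurable_indicator Cs q)
    also have "\<dots> = (LINT \<omega>:?C|P. ?q (?\<Phi> \<omega>))"
      unfolding set_lebesgue_integral_def
      by (rule Bochner_Integration.integral_cong) (auto simp: indicator_def)
    finally show ?thesis ..
  qed
  finally show "measure ?D ?A = (LINT \<omega>:C|?D. ?q \<omega>)" .
qed

end

section \<open>Rewards along non-explosive paths\<close>

lemma smp_measure_prob:
  assumes "smp_measure ME Q x P"
  shows "prob_space P" "sets P = sets (Omega_M ME)" "space P = space (Omega_M ME)"
  using assms sets_eq_imp_space_eq[of P "Omega_M ME"] by (simp_all add: smp_measure_def)

text \<open>The kernel vanishes at time 0, so no holding time is 0 with positive probability. Strict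
  positivity ensures that the state at the instant S_k is X_k.\<close>

lemma AE_Ts_pos:
  assumes P: "smp_measure ME Q x P" and Q: "semi_markov_kernel ME Q"
  shows "AE \<omega> in P. \<forall>n. 0 < Ts (Suc n) \<omega>"
  unfolding AE_all_countable
proof
  fix n
  interpret prob_space P by (rule smp_measure_prob[OF P])
  note sp = smp_measure_prob(3)[OF P]
  let ?N = "{\<omega>\<in>space P. Ts (Suc n) \<omega> \<le> 0 \<and> Xs (Suc n) \<omega> \<in> space ME}"
  have X: "Xs m \<omega> \<in> space ME" if "\<omega> \<in> space P" for m \<omega>
    using measurable_space[OF measurable_Xs] that sp by simp
  have "?N \<in> sets (Omega_M ME)"
  proof -
    have "Measurable.pred (Omega_M ME) (\<lambda>\<omega>. Ts (Suc n) \<omega> \<in> {..0} \<and> Xs (Suc n) \<omega> \<in> space ME)"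
      by (intro pred_intros_logic(3) pred_sets2[OF sets.top measurable_Xs]
          pred_sets2[OF _ measurable_RplusD[OF measurable_Ts_Suc]]) simp
    then show ?thesis by (simp add: pred_def sp)
  qed
  then have N: "?N \<in> sets P" by (simp add: smp_measure_prob[OF P])
  have "space P \<in> sets (Filt ME n)"
    using sets.top[of "Filt ME n"] by (simp add: sp)
  from smp_measure_step[OF P order_refl sets.top this]
  have "measure P (?N \<inter> space P) = (LINT \<omega>:space P|P. Q 0 (space ME) (Xs n \<omega>))" .
  also have "\<dots> = (LINT \<omega>:space P|P. 0)"
    by (rule set_lebesgue_integral_cong) (auto simp: kernel_0[OF Q sets.top X])
  also have "?N \<inter> space P = ?N" by blast
  finally have "measure P ?N = 0" by simp
  then have "AE \<omega> in P. \<omega> \<notin> ?N"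
    using N by (subst (asm) prob_eq_0) auto
  then show "AE \<omega> in P. 0 < Ts (Suc n) \<omega>"
    using AE_space
  proof eventually_elim
    case (elim \<omega>)
    then show ?case using X[of \<omega> "Suc n"] by (simp add: not_le)
  qed
qed

text \<open>Given the past, a holding time is at most \<delta> with probability at most 1 -
  \<epsilon>. Hence k consecutive short ones starting from any index m have probability at most the
  k-th power of 1 - \<epsilon>, which tends to 0.\<close>

lemma AE_Ts_frequently:
  assumes P: "smp_measure ME Q x P" and Q: "semi_markov_kernel ME Q"
    and x: "x \<in> space ME"
    and \<delta>: "0 < \<delta>" and \<epsilon>: "0 < \<epsilon>" and reg: "\<And>y. y \<in> space ME \<Longrightarrow> Q \<delta> (space ME) y \<le> 1 - \<epsilon>"
  shows "AE \<omega> in P. \<forall>m. \<exists>k\<ge>m. \<delta> < Ts (Suc k) \<omega>"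
  unfolding AE_all_countable
proof
  fix m
  interpret prob_space P by (rule smp_measure_prob[OF P])
  note sp = smp_measure_prob(3)[OF P]
  define C where "C k = {\<omega>\<in>space P. \<forall>i\<in>{..<k}. Ts (Suc (m + i)) \<omega> \<in> {..\<delta>}}" for k
  have X: "Xs n \<omega> \<in> space ME" if "\<omega> \<in> space P" for n \<omega>
    using measurable_space[OF measurable_Xs] that sp by simp
  have CF: "C k \<in> sets (Filt ME (m + k))" for k
  proof -
    have "Measurable.pred (Filt ME (m + k)) (\<lambda>\<omega>. \<forall>i\<in>{..<k}. Ts (Suc (m + i)) \<omega> \<in> {..\<delta>})"
      by (intro pred_intros_finite(3) pred_sets2[OF _ measurable_RplusD[OF measurable_Ts_Filt]]) auto
    then show ?thesis by (simp add: pred_def C_def sp)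
  qed
  have CP: "C k \<in> sets P" for k
    using CF[of k] sets_Filt_subset by (auto simp: smp_measure_prob[OF P])
  \<comment> \<open>Evaluating the kernel at the single point x bounds 1 - \<epsilon> below by a
    nonnegative number.\<close>
  have e1: "0 \<le> 1 - \<epsilon>" "1 - \<epsilon> < 1"
    using kernel_bounds(1)[OF Q less_imp_le[OF \<delta>] sets.top x] reg[OF x] \<epsilon> by auto
  have le: "measure P (C k) \<le> (1 - \<epsilon>) ^ k" for k
  proof (induction k)
    case (Suc k)
    \<comment> \<open>The first k short holding times form an event of the past; the next one is
      controlled by the kernel.\<close>
    have Cs: "C (Suc k) = {\<omega>\<in>space P. Ts (Suc (m + k)) \<omega> \<le> \<delta> \<and> Xs (Suc (m + k)) \<omega> \<in> space ME} \<inter> C k"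
      using X by (auto simp: C_def lessThan_Suc)
    have "measure P (C (Suc k)) = (LINT \<omega>:C k|P. Q \<delta> (space ME) (Xs (m + k) \<omega>))"
      unfolding Cs by (rule smp_measure_step[OF P less_imp_le[OF \<delta>] sets.top CF])
    also have "\<dots> \<le> (LINT \<omega>:C k|P. 1 - \<epsilon>)"
    proof (rule set_integral_mono)
      have q: "(\<lambda>\<omega>. Q \<delta> (space ME) (Xs (m + k) \<omega>)) \<in> borel_measurable P"
        using measurable_compose[OF measurable_Xs kernel_measurable[OF Q less_imp_le[OF \<delta>] sets.top]]
        by (subst measurable_cong_sets[OF smp_measure_prob(2)[OF P] refl])
      have "integrable P (\<lambda>\<omega>. Q \<delta> (space ME) (Xs (m + k) \<omega>))"
        by (rule integrable_const_bound[where B = 1, OF _ q])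
          (intro AE_I2, use kernel_bounds[OF Q less_imp_le[OF \<delta>] sets.top X] in simp)
      from integrable_mult_indicator[OF CP this]
      show "set_integrable P (C k) (\<lambda>\<omega>. Q \<delta> (space ME) (Xs (m + k) \<omega>))"
        by (simp add: set_integrable_def)
      show "set_integrable P (C k) (\<lambda>\<omega>. 1 - \<epsilon>)"
        using integrable_mult_indicator[OF CP, of "\<lambda>_. 1 - \<epsilon>"] by (simp add: set_integrable_def)
      show "Q \<delta> (space ME) (Xs (m + k) \<omega>) \<le> 1 - \<epsilon>" if "\<omega> \<in> C k" for \<omega>
        using that by (intro reg X) (simp add: C_def)
    qed
    also have "\<dots> = (1 - \<epsilon>) * measure P (C k)"
      using CP by (simp add: set_lebesgue_integral_def mult.commute)
    also have "\<dots> \<le> (1 - \<epsilon>) ^ Suc k"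
      using mult_left_mono[OF Suc e1(1)] by simp
    finally show ?case .
  qed (simp add: prob_le_1)
  let ?N = "\<Inter>k. C k"
  have N: "?N \<in> sets P" using CP by auto
  have "measure P ?N \<le> (1 - \<epsilon>) ^ k" for k
    by (rule order_trans[OF finite_measure_mono[OF _ CP] le]) auto
  moreover have "(\<lambda>k. (1 - \<epsilon>) ^ k) \<longlonglongrightarrow> 0"
    using e1 by (intro LIMSEQ_realpow_zero)
  ultimately have "measure P ?N \<le> 0"
    by (intro LIMSEQ_le_const) auto
  then have "measure P ?N = 0"
    by (rule antisym[OF _ measure_nonneg])
  then have "AE \<omega> in P. \<omega> \<notin> ?N"
    using N by (subst (asm) prob_eq_0) auto
  then show "AE \<omega> in P. \<exists>k\<ge>m. \<delta> < Ts (Suc k) \<omega>"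
  proof (rule AE_mp[OF _ AE_I2[OF impI]])
    fix \<omega> assume "\<omega> \<in> space P" "\<omega> \<notin> ?N"
    then obtain i where "\<delta> < Ts (Suc (m + i)) \<omega>"
      by (auto simp: C_def not_le)
    then show "\<exists>k\<ge>m. \<delta> < Ts (Suc k) \<omega>"
      by (intro exI[of _ "m + i"]) simp
  qed
qed

lemma Ss_0: "Ss 0 \<omega> = 0" and Ss_Suc: "Ss (Suc n) \<omega> = Ss n \<omega> + Ts (Suc n) \<omega>"
  by (simp_all add: Ss_def Ts_def)

lemma Sh_0: "Sh 0 \<omega> = 0" and Sh_Suc: "Sh (Suc n) \<omega> = Sh n \<omega> + Th (Suc n) \<omega>"
  by (simp_all add: Sh_def Th_def)

text \<open>Beyond any index there is another holding time longer than \<delta>, so each multiple of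
  \<delta> is reached in turn.\<close>

lemma Ss_unbounded:
  assumes pos: "\<And>n. 0 \<le> Ts (Suc n) \<omega>" and \<delta>: "0 < \<delta>" and freq: "\<And>m. \<exists>k\<ge>m. \<delta> < Ts (Suc k) \<omega>"
  shows "\<exists>n. K < Ss n \<omega>"
proof -
  have inc: "incseq (\<lambda>n. Ss n \<omega>)"
    by (rule incseq_SucI) (simp add: Ss_Suc pos)
  have "\<exists>n. real N * \<delta> \<le> Ss n \<omega>" for N
  proof (induction N)
    case 0
    show ?case by (intro exI[of _ 0]) (simp add: Ss_0)
  next
    case (Suc N)
    then obtain n where n: "real N * \<delta> \<le> Ss n \<omega>" by blast
    from freq[of n] obtain k where k: "n \<le> k" "\<delta> < Ts (Suc k) \<omega>" by blast
    have "real (Suc N) * \<delta> \<le> Ss n \<omega> + \<delta>"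
      using n by (simp add: algebra_simps)
    also have "\<dots> \<le> Ss (Suc k) \<omega>"
      using incseqD[OF inc k(1)] k(2) by (simp add: Ss_Suc)
    finally show ?case by blast
  qed
  moreover obtain N :: nat where "K < real N * \<delta>"
    using reals_Archimedean3[OF \<delta>] by blast
  ultimately show ?thesis
    by (blast intro: less_le_trans)
qed

section \<open>The jump index at a given time\<close>

lemma jump_index_unique:
  fixes S :: "nat \<Rightarrow> real"
  assumes "incseq S" "S i \<le> t" "t < S (Suc i)" "S j \<le> t" "t < S (Suc j)"
  shows "i = j"
proof -
  have *: "a \<le> b" if "S a \<le> t" "t < S (Suc b)" for a b
  proof (rule ccontr)
    assume "\<not> a \<le> b"
    then have "S (Suc b) \<le> S a" using incseqD[OF assms(1), of "Suc b" a] by simp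
    then show False using that by simp
  qed
  show ?thesis
    by (rule antisym[OF *[OF assms(2,5)] *[OF assms(4,3)]])
qed

lemma jump_index_eq:
  fixes S :: "nat \<Rightarrow> real"
  assumes "incseq S" "S i \<le> t" "t < S (Suc i)"
  shows "(THE n. S n \<le> t \<and> t < S (Suc n)) = i"
proof (rule the_equality)
  show "S i \<le> t \<and> t < S (Suc i)" using assms by simp
  show "n = i" if "S n \<le> t \<and> t < S (Suc n)" for n
    by (rule jump_index_unique[OF assms(1)]) (use that assms in simp_all)
qed

text \<open>The predecessor of the first index whose value exceeds t. The bound by N later ensures
  that a time before the stop has an index before the stopping index.\<close>

lemma jump_index_exists:
  fixes S :: "nat \<Rightarrow> real"
  assumes "S 0 \<le> t" "t < S N"
  shows "\<exists>n<N. S n \<le> t \<and> t < S (Suc n)"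
proof -
  define m where "m = (LEAST m. t < S m)"
  have m: "t < S m" "m \<le> N"
    unfolding m_def by (rule LeastI[of "\<lambda>m. t < S m", OF assms(2)], rule Least_le[of "\<lambda>m. t < S m", OF assms(2)])
  have "m \<noteq> 0"
  proof
    assume "m = 0"
    then show False using m(1) assms(1) by simp
  qed
  then obtain n where n: "m = Suc n" by (cases m) auto
  have "\<not> t < S n"
    by (rule not_less_Least) (simp only: m_def[symmetric] n lessI)
  then show ?thesis using m n by (intro exI[of _ n]) simp
qed

section \<open>Measurability of the reward of the decision process\<close>

definition hat_reward :: "('e \<Rightarrow> real) \<Rightarrow> ('e \<Rightarrow> real) \<Rightarrow> real \<Rightarrow> 'e homega \<Rightarrow> ennreal" where
  "hat_reward c g s \<omega> =
     (\<integral>\<^sup>+ t. ennreal (chat c (Xht t \<omega>) (Aht t \<omega>)) * indicator {0..s} t \<partial>lborel)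
     + ennreal (ghat g (Xht s \<omega>) (Aht s \<omega>))"

lemma incseq_Sh: "\<omega> \<in> space (Omegahat_M ME) \<Longrightarrow> incseq (\<lambda>n. Sh n \<omega>)"
  by (rule incseq_SucI) (simp add: Sh_Suc Th_Suc_nonneg)

text \<open>Monotone jump times allow at most one index, and uniqueness is all that measurability of
  a definite description asks for; explosive paths, where no index may exist, are covered.\<close>

lemma measurable_jump_index:
  "(\<lambda>z. THE n. Sh n (fst z) \<le> snd z \<and> snd z < Sh (Suc n) (fst z))
    \<in> Omegahat_M ME \<Otimes>\<^sub>M borel \<rightarrow>\<^sub>M count_space UNIV"
proof (rule measurable_THE[where I = UNIV])
  have S: "(\<lambda>z. Sh n (fst z)) \<in> borel_measurable (Omegahat_M ME \<Otimes>\<^sub>M borel)" for n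
    by (rule measurable_compose[OF measurable_fst measurable_Sh])
  have s: "snd \<in> borel_measurable (Omegahat_M ME \<Otimes>\<^sub>M borel)"
    by (rule measurable_snd)
  show "Measurable.pred (Omegahat_M ME \<Otimes>\<^sub>M borel) (\<lambda>z. Sh n (fst z) \<le> snd z \<and> snd z < Sh (Suc n) (fst z))" for n
    using borel_measurable_le[OF S s] borel_measurable_less[OF s S]
    by (intro pred_intros_logic(3)) (simp_all add: pred_def)
  show "i = j" if "z \<in> space (Omegahat_M ME \<Otimes>\<^sub>M borel)"
    "Sh i (fst z) \<le> snd z \<and> snd z < Sh (Suc i) (fst z)" "Sh j (fst z) \<le> snd z \<and> snd z < Sh (Suc j) (fst z)" for z i j
    by (rule jump_index_unique[OF incseq_Sh[of "fst z" ME], where t = "snd z"])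
      (use that in \<open>auto simp: space_pair_measure\<close>)
qed simp_all

lemma measurable_Xht: "(\<lambda>z. Xht (snd z) (fst z)) \<in> Omegahat_M ME \<Otimes>\<^sub>M borel \<rightarrow>\<^sub>M Ehat_M ME"
  unfolding Xht_def
  by (rule measurable_compose_countable[OF measurable_compose[OF measurable_fst measurable_Xh] measurable_jump_index])

lemma measurable_Aht: "(\<lambda>z. Aht (snd z) (fst z)) \<in> Omegahat_M ME \<Otimes>\<^sub>M borel \<rightarrow>\<^sub>M A_M"
  unfolding Aht_def
  by (rule measurable_compose_countable[OF measurable_compose[OF measurable_fst measurable_Ah] measurable_jump_index])

text \<open>One statement for both rewards: a = 0 gives the shape of \<open>chat\<close>, a = 1 that
  of \<open>ghat\<close>.\<close>

lemma measurable_cost: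
  assumes c: "c \<in> borel_measurable ME" and x0: "x0 \<in> space ME"
  shows "(\<lambda>z. if fst z \<noteq> None \<and> snd z = a then c (the (fst z)) else 0) \<in> borel_measurable (Ehat_M ME \<Otimes>\<^sub>M A_M)"
proof -
  have "(\<lambda>z. if fst z \<noteq> None \<and> snd z \<in> {a} then c (the_or x0 (fst z)) else 0) \<in> borel_measurable (Ehat_M ME \<Otimes>\<^sub>M A_M)"
  proof (rule measurable_If)
    show "{z \<in> space (Ehat_M ME \<Otimes>\<^sub>M A_M). fst z \<noteq> None \<and> snd z \<in> {a}} \<in> sets (Ehat_M ME \<Otimes>\<^sub>M A_M)"
      unfolding pred_def[symmetric]
      by (rule pred_intros_logic(3)[OF measurable_compose[OF measurable_fst pred_not_None]
            pred_sets2[OF _ measurable_A_MD[OF measurable_snd]]]) simp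
    show "(\<lambda>z. c (the_or x0 (fst z))) \<in> borel_measurable (Ehat_M ME \<Otimes>\<^sub>M A_M)"
      by (rule measurable_compose[OF measurable_compose[OF measurable_fst measurable_the_or[OF x0]] c])
  qed simp
  moreover have "(\<lambda>z. if fst z \<noteq> None \<and> snd z \<in> {a} then c (the_or x0 (fst z)) else 0)
      = (\<lambda>z. if fst z \<noteq> None \<and> snd z = a then c (the (fst z)) else 0)"
    by (auto simp: fun_eq_iff the_or_def)
  ultimately show ?thesis by (simp only:)
qed

lemma measurable_hat_reward:
  assumes c: "c \<in> borel_measurable ME" and g: "g \<in> borel_measurable ME" and x0: "x0 \<in> space ME"
  shows "hat_reward c g s \<in> borel_measurable (Omegahat_M ME)"
proof -
  note XA = measurable_Pair[OF measurable_Xht measurable_Aht]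
  have 1: "(\<lambda>z. chat c (Xht (snd z) (fst z)) (Aht (snd z) (fst z))) \<in> borel_measurable (Omegahat_M ME \<Otimes>\<^sub>M borel)"
    using measurable_compose[OF XA measurable_cost[OF c x0, of 0]] by (simp only: chat_def fst_conv snd_conv)
  have 2: "(\<lambda>z. ghat g (Xht (snd z) (fst z)) (Aht (snd z) (fst z))) \<in> borel_measurable (Omegahat_M ME \<Otimes>\<^sub>M borel)"
    using measurable_compose[OF XA measurable_cost[OF g x0, of 1]] by (simp only: ghat_def fst_conv snd_conv)
  have lb: "sets (Omegahat_M ME \<Otimes>\<^sub>M lborel) = sets (Omegahat_M ME \<Otimes>\<^sub>M borel)"
    by (rule sets_pair_measure_cong) simp_all
  have "(\<lambda>z. ennreal (chat c (Xht (snd z) (fst z)) (Aht (snd z) (fst z))) * indicator {0..s} (snd z))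
      \<in> borel_measurable (Omegahat_M ME \<Otimes>\<^sub>M borel)"
    by (intro borel_measurable_times_ennreal measurable_compose[OF 1 measurable_ennreal]
        measurable_compose[OF measurable_snd borel_measurable_indicator]) simp
  then have 3: "(\<lambda>z. ennreal (chat c (Xht (snd z) (fst z)) (Aht (snd z) (fst z))) * indicator {0..s} (snd z))
      \<in> borel_measurable (Omegahat_M ME \<Otimes>\<^sub>M lborel)"
    by (subst measurable_cong_sets[OF lb refl])
  have "(\<lambda>\<omega>. \<integral>\<^sup>+ t. ennreal (chat c (Xht t \<omega>) (Aht t \<omega>)) * indicator {0..s} t \<partial>lborel)
      \<in> borel_measurable (Omegahat_M ME)"
    using lborel.borel_measurable_nn_integral[of "\<lambda>\<omega> t. ennreal (chat c (Xht t \<omega>) (Aht t \<omega>)) * indicator {0..s} t" "Omegahat_M ME"] 3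
    by (simp add: split_beta')
  moreover have "(\<lambda>\<omega>. ennreal (ghat g (Xht s \<omega>) (Aht s \<omega>))) \<in> borel_measurable (Omegahat_M ME)"
  proof -
    have "(\<lambda>\<omega>. (\<omega>, s)) \<in> Omegahat_M ME \<rightarrow>\<^sub>M Omegahat_M ME \<Otimes>\<^sub>M borel"
      by (intro measurable_Pair measurable_ident_sets measurable_const) simp_all
    from measurable_compose[OF measurable_compose[OF this 2] measurable_ennreal] show ?thesis by simp
  qed
  ultimately show ?thesis
    unfolding hat_reward_def by (rule borel_measurable_add)
qed

section \<open>Pathwise comparison of the rewards\<close>

lemma Stau_less_iff:
  assumes unb: "\<And>K. \<exists>n. K < Ss n \<omega>"
  shows "Stau \<tau> \<omega> < ereal s \<longleftrightarrow> (\<exists>k. stopped_at \<tau> s k \<omega>)"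
proof (cases "\<tau> \<omega>")
  case (enat k)
  then show ?thesis by (auto simp: stopped_at_def Stau_def)
next
  case infinity
  \<comment> \<open>When \<tau> is infinite, unbounded jump times push the limit of the S_n beyond
    s, so such a path never counts as stopped before s.\<close>
  obtain n where "s < Ss n \<omega>" using unb by blast
  then have "ereal s \<le> (SUP n. ereal (Ss n \<omega>))"
    by (intro SUP_upper2[of n]) auto
  then show ?thesis using infinity by (auto simp: stopped_at_def Stau_def)
qed

lemma reward_stop_path:
  assumes pos: "\<And>n. 0 < Ts (Suc n) \<omega>" and unb: "\<And>K. \<exists>n. K < Ss n \<omega>" and s: "s \<le> T" and T: "0 \<le> T"
  shows "hat_reward c g s (stop_path T \<tau> s \<omega>) = reward c g \<tau> s \<omega>"
proof -
  let ?\<Phi> = "stop_path T \<tau> s \<omega>"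
  have inc: "incseq (\<lambda>n. Ss n \<omega>)"
    by (rule incseq_SucI) (simp add: Ss_Suc less_imp_le[OF pos])
  have inch: "incseq (\<lambda>n. Sh n ?\<Phi>)"
    by (rule incseq_SucI) (simp add: Sh_Suc Th_stop_path less_imp_le[OF pos] T)
  note ix = jump_index_eq[OF inc] and ixh = jump_index_eq[OF inch]
  show ?thesis
  proof (cases "\<exists>k. stopped_at \<tau> s k \<omega>")
    case False
    \<comment> \<open>Without a stop both paths share clock and states forever, and the terminal
      term vanishes because the action is 0.\<close>
    have "Sh n ?\<Phi> = Ss n \<omega>" for n using False by (intro Sh_stop_path) blast
    moreover have "Xh n ?\<Phi> = Some (Xs n \<omega>)" "Ah n ?\<Phi> = 0" for n
      using False by (auto simp: Xh_stop_path Ah_stop_path)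
    ultimately have "Xht t ?\<Phi> = Some (Xt t \<omega>)" "Aht t ?\<Phi> = 0" for t
      by (simp_all add: Xht_def Xt_def Aht_def)
    then show ?thesis
      using False Stau_less_iff[OF unb] by (simp add: hat_reward_def reward_def chat_def ghat_def)
  next
    case True
    then obtain k where k: "stopped_at \<tau> s k \<omega>" by blast
    then have \<tau>: "\<tau> \<omega> = enat k" "Ss k \<omega> < s" by (simp_all add: stopped_at_def)
    have only: "stopped_at \<tau> s j \<omega> \<longleftrightarrow> j = k" for j
      using \<tau> by (auto simp: stopped_at_def)
    have Sh: "Sh n ?\<Phi> = Ss n \<omega>" if "n \<le> k" for n
      using that by (intro Sh_stop_path) (simp add: only)
    have Shk: "Sh (Suc k) ?\<Phi> = Ss k \<omega> + (T + 1)"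
      using Sh[of k] by (simp add: Sh_Suc Th_stop_path only)
    have S0: "0 \<le> Ss k \<omega>" using incseqD[OF inc, of 0 k] by (simp add: Ss_0)
    \<comment> \<open>Before the stop the jump index is below k, where the two clocks agree up to
      and including the next jump.\<close>
    have before: "Xht t ?\<Phi> = Some (Xt t \<omega>)" "Aht t ?\<Phi> = 0" if t: "0 \<le> t" "t < Ss k \<omega>" for t
    proof -
      obtain n where n: "n < k" "Ss n \<omega> \<le> t" "t < Ss (Suc n) \<omega>"
        using jump_index_exists[of "\<lambda>n. Ss n \<omega>" t k] t by (auto simp: Ss_0)
      have "(THE n. Ss n \<omega> \<le> t \<and> t < Ss (Suc n) \<omega>) = n"
        "(THE n. Sh n ?\<Phi> \<le> t \<and> t < Sh (Suc n) ?\<Phi>) = n"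
        using n by (auto intro!: ix ixh simp: Sh)
      then show "Xht t ?\<Phi> = Some (Xt t \<omega>)" "Aht t ?\<Phi> = 0"
        using n(1) by (simp_all add: Xht_def Xt_def Aht_def Xh_stop_path Ah_stop_path only)
    qed
    have after: "Xht t ?\<Phi> = Some (Xs k \<omega>)" "Aht t ?\<Phi> = 1" if t: "Ss k \<omega> \<le> t" "t \<le> s" for t
    proof -
      have "(THE n. Sh n ?\<Phi> \<le> t \<and> t < Sh (Suc n) ?\<Phi>) = k"
        by (rule ixh) (use t s S0 in \<open>simp_all add: Sh Shk\<close>)
      then show "Xht t ?\<Phi> = Some (Xs k \<omega>)" "Aht t ?\<Phi> = 1"
        by (simp_all add: Xht_def Aht_def Xh_stop_path Ah_stop_path only)
    qed
    \<comment> \<open>Index k is the one valid at the instant S_k because the following holding time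
      is strictly positive.\<close>
    have Xtk: "Xt (Ss k \<omega>) \<omega> = Xs k \<omega>"
      using ix[of k "Ss k \<omega>"] pos by (simp add: Xt_def Ss_Suc)
    have "(\<integral>\<^sup>+ t. ennreal (chat c (Xht t ?\<Phi>) (Aht t ?\<Phi>)) * indicator {0..s} t \<partial>lborel)
        = (\<integral>\<^sup>+ t. ennreal (c (Xt t \<omega>)) * indicator {0..Ss k \<omega>} t \<partial>lborel)"
    \<comment> \<open>At t = S_k the integrands may differ: the closed interval still charges c on
      the right, while action 1 already switches the cost off on the left.\<close>
    proof (rule nn_integral_cong_AE)
      show "AE t in lborel. ennreal (chat c (Xht t ?\<Phi>) (Aht t ?\<Phi>)) * indicator {0..s} t
          = ennreal (c (Xt t \<omega>)) * indicator {0..Ss k \<omega>} t"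
        using AE_lborel_singleton[of "Ss k \<omega>"]
      proof eventually_elim
        fix t :: real assume "t \<noteq> Ss k \<omega>"
        then consider "t < 0 \<or> s < t" | "0 \<le> t" "t < Ss k \<omega>" | "Ss k \<omega> < t" "t \<le> s"
          by linarith
        then show "ennreal (chat c (Xht t ?\<Phi>) (Aht t ?\<Phi>)) * indicator {0..s} t
            = ennreal (c (Xt t \<omega>)) * indicator {0..Ss k \<omega>} t"
        proof cases
          case 1 then show ?thesis using \<tau>(2) by (auto simp: indicator_def)
        next
          case 2 then show ?thesis using before[OF 2] \<tau>(2) by (simp add: chat_def indicator_def)
        next
          case 3 then show ?thesis using after[of t] by (simp add: chat_def indicator_def)
        qed
      qed
    qed
    moreover have "ghat g (Xht s ?\<Phi>) (Aht s ?\<Phi>) = g (Xs k \<omega>)"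
      using after[of s] \<tau>(2) by (simp add: ghat_def)
    moreover have "Stau \<tau> \<omega> = ereal (Ss k \<omega>)" using \<tau>(1) by (simp add: Stau_def)
    ultimately show ?thesis
      using \<tau>(2) Xtk by (simp add: hat_reward_def reward_def)
  qed
qed

lemma reward_tau_pi:
  assumes st: "stopping_time_smp ME \<tau>" and w: "\<omega> \<in> space (Omega_M ME)"
    and unb: "\<And>K. \<exists>n. K < Ss n \<omega>"
  shows "reward c g (tau_pi (d_tau ME \<tau>) s) s \<omega> = reward c g \<tau> s \<omega>"
proof -
  let ?\<sigma> = "tau_pi (d_tau ME \<tau>) s"
  have d: "d_tau ME \<tau> n (s - Ss n \<omega>) (Y0 n \<omega>) = 1 \<longleftrightarrow> stopped_at \<tau> s n \<omega>" for n
    by (simp add: d_tau_Y0[OF st w])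
  show ?thesis
  proof (cases "\<exists>k. stopped_at \<tau> s k \<omega>")
    case True
    then obtain k where k: "stopped_at \<tau> s k \<omega>" by blast
    \<comment> \<open>Only one index can satisfy the condition, so the least one is the value of
      \<tau>.\<close>
    have "(LEAST n. stopped_at \<tau> s n \<omega>) = k"
      by (rule Least_equality[of "\<lambda>n. stopped_at \<tau> s n \<omega>", OF k]) (use k in \<open>auto simp: stopped_at_def\<close>)
    then have "?\<sigma> \<omega> = \<tau> \<omega>"
      using True k unfolding tau_pi_def d by (simp add: stopped_at_def)
    then have "Stau ?\<sigma> \<omega> = Stau \<tau> \<omega>" by (simp add: Stau_def)
    then show ?thesis by (simp add: reward_def)
  next
    case False
    then have \<sigma>: "?\<sigma> \<omega> = \<infinity>" unfolding tau_pi_def d by simp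
    \<comment> \<open>The criterion is applied to both stopping times; an infinite one has no
      stopping index.\<close>
    have "\<not> Stau ?\<sigma> \<omega> < ereal s" "\<not> Stau \<tau> \<omega> < ereal s"
      unfolding Stau_less_iff[OF unb] using False \<sigma> by (simp_all add: stopped_at_def)
    then show ?thesis by (simp add: reward_def)
  qed
qed

theorem theorem4p2:
  fixes S :: "'e::polish_space set"
    and Q :: "real \<Rightarrow> 'e set \<Rightarrow> 'e \<Rightarrow> real"
    and c g :: "'e \<Rightarrow> real"
    and T :: real
    and \<tau> :: "'e omega \<Rightarrow> enat"
    and P :: "'e \<Rightarrow> 'e omega measure"
    and Ph :: "real \<Rightarrow> 'e \<Rightarrow> 'e homega measure"
  assumes borel_space: "S \<in> sets borel"
    and kernel: "semi_markov_kernel (restrict_space borel S) Q"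
    and regular: "\<exists>\<delta>>0. \<exists>\<epsilon>>0. \<forall>x\<in>S. Q \<delta> S x \<le> 1 - \<epsilon>"
    and c_meas: "c \<in> borel_measurable (restrict_space borel S)" and c_nonneg: "\<forall>x\<in>S. c x \<ge> 0"
    and g_meas: "g \<in> borel_measurable (restrict_space borel S)" and g_nonneg: "\<forall>x\<in>S. g x \<ge> 0"
    and T_nonneg: "T \<ge> 0"
    and stopping: "stopping_time_smp (restrict_space borel S) \<tau>"
    and P_law: "\<forall>x\<in>S. smp_measure (restrict_space borel S) Q x (P x)"
    and Ph_law: "\<forall>s\<in>{0..T}. \<forall>x\<in>S.
          smdp_measure (restrict_space borel S) T Q (d_tau (restrict_space borel S) \<tau>) s (Some x) (Ph s x)"
  shows "\<forall>s\<in>{0..T}. \<forall>x\<in>S.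
           Vval P c g \<tau> s x = Uval Ph c g s x \<and>
           Uval Ph c g s x = Vval P c g (tau_pi (d_tau (restrict_space borel S) \<tau>) s) s x"
proof (intro ballI)
  fix s x assume s: "s \<in> {0..T}" and xS: "x \<in> S"
  let ?ME = "restrict_space borel S"
  let ?\<Phi> = "stop_path T \<tau> s"
  have sp: "space ?ME = S" by (simp add: space_restrict_space)
  have x: "x \<in> space ?ME" using xS sp by simp
  \<comment> \<open>Points of a Polish space are closed, hence Borel.\<close>
  have sx: "{x} \<in> sets ?ME"
    unfolding sets_restrict_space by (rule image_eqI[where x = "{x}"]) (use xS in auto)
  have P: "smp_measure ?ME Q x (P x)" using P_law xS by blast
  have eqD: "Ph s x = distr (P x) (Omegahat_M ?ME) ?\<Phi>"
  proof (rule smdp_measure_unique)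
    show "smdp_measure ?ME T Q (d_tau ?ME \<tau>) s (Some x) (Ph s x)"
      using Ph_law s xS by blast
    show "smdp_measure ?ME T Q (d_tau ?ME \<tau>) s (Some x) (distr (P x) (Omegahat_M ?ME) ?\<Phi>)"
      by (rule smdp_measure_stop_path[OF stopping T_nonneg P kernel x sx])
  qed (use x in \<open>simp_all add: measurable_d_tau[OF stopping x] measurable_Qhat[OF kernel _ _ x]\<close>)
  from regular obtain \<delta> \<epsilon> where \<delta>: "0 < \<delta>" and \<epsilon>: "0 < \<epsilon>"
    and reg: "\<And>y. y \<in> space ?ME \<Longrightarrow> Q \<delta> (space ?ME) y \<le> 1 - \<epsilon>"
    unfolding sp by blast
  have freq: "AE \<omega> in P x. \<forall>m. \<exists>k\<ge>m. \<delta> < Ts (Suc k) \<omega>"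
    by (rule AE_Ts_frequently[OF P kernel x \<delta> \<epsilon>]) (rule reg)
  have good: "AE \<omega> in P x. \<omega> \<in> space (Omega_M ?ME) \<and> (\<forall>n. 0 < Ts (Suc n) \<omega>) \<and> (\<forall>K. \<exists>n. K < Ss n \<omega>)"
    using AE_Ts_pos[OF P kernel] freq AE_space
  proof eventually_elim
    case (elim \<omega>)
    then have "0 \<le> Ts (Suc n) \<omega>" "\<exists>k\<ge>n. \<delta> < Ts (Suc k) \<omega>" for n
      by (simp_all add: less_imp_le)
    from Ss_unbounded[of \<omega>, OF this(1) \<delta> this(2)] show ?case
      using elim smp_measure_prob(3)[OF P] by simp
  qed
  have \<Phi>: "?\<Phi> \<in> P x \<rightarrow>\<^sub>M Omegahat_M ?ME"
    by (subst measurable_cong_sets[OF smp_measure_prob(2)[OF P] refl])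
      (rule measurable_stop_path[OF stopping T_nonneg])
  have "Uval Ph c g s x = (\<integral>\<^sup>+ \<omega>. hat_reward c g s \<omega> \<partial>Ph s x)"
    by (simp add: Uval_def hat_reward_def)
  \<comment> \<open>Change of variables needs measurability of \<open>hat_reward\<close> only; the
    rewards of the stopped process enter through almost sure equality of integrands.\<close>
  also have "\<dots> = (\<integral>\<^sup>+ \<omega>. hat_reward c g s (?\<Phi> \<omega>) \<partial>P x)"
    unfolding eqD by (rule nn_integral_distr[OF \<Phi>])
      (simp only: measurable_distr_eq1 measurable_hat_reward[OF c_meas g_meas x])
  also have "\<dots> = Vval P c g \<tau> s x"
    unfolding Vval_def
  proof (rule nn_integral_cong_AE)
    show "AE \<omega> in P x. hat_reward c g s (?\<Phi> \<omega>) = reward c g \<tau> s \<omega>"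
      using good by eventually_elim (use s T_nonneg in \<open>simp add: reward_stop_path\<close>)
  qed
  finally have U: "Uval Ph c g s x = Vval P c g \<tau> s x" .
  have "Vval P c g (tau_pi (d_tau ?ME \<tau>) s) s x = Vval P c g \<tau> s x"
    unfolding Vval_def
  proof (rule nn_integral_cong_AE)
    show "AE \<omega> in P x. reward c g (tau_pi (d_tau ?ME \<tau>) s) s \<omega> = reward c g \<tau> s \<omega>"
      using good by eventually_elim (use stopping in \<open>simp add: reward_tau_pi\<close>)
  qed
  with U show "Vval P c g \<tau> s x = Uval Ph c g s x \<and>
      Uval Ph c g s x = Vval P c g (tau_pi (d_tau ?ME \<tau>) s) s x"
    by simp
qed

end
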